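(* Let $d_1,\ldots,d_n$ be nonnegative integers, and let $\alpha_1,\ldots,\alpha_n$ be integers such that $0\le\alpha_i\le d_i$ for all $i$ and $d_1=\alpha_2+\cdots+\alpha_n$. Let $c\in\Bbbk$ be any nonzero constant and define the ideal \[K'=(x_1^{d_1}+c\,x_2^{\alpha_2}\cdots x_n^{\alpha_n},\, x_2^{d_2},\ldots,x_n^{d_n})+x_1^{d_1-\alpha_1}(x_2^{d_2-\alpha_2},\ldots,x_n^{d_n-\alpha_n})\] of $R=\Bbbk[x_1,\ldots,x_n]$. Then $R/K'$ is Gorenstein and has the SLP, unless $K'=R$.
   Context: $\Bbbk$ is a field of characteristic zero and $R=\Bbbk[x_1,\ldots,x_n]$ is the standard graded polynomial ring. A standard graded algebra $A$ (usually Artinian) has the strong Lefschetz property (SLP) if there is a linear form $\ell\in A_1$ such that for all $j\ge 1$ and all $i$ the multiplication map $\cdot\ell^j:A_i\to A_{i+j}$ has maximal rank (i.e. is injective or surjective). *)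

theory Defs
  imports
    "HOL-Library.Poly_Mapping"
    "HOL-Algebra.QuotRing"
    "HOL-Algebra.Ideal_Product"
    "HOL-Algebra.Embedded_Algebras"
begin

section \<open>The polynomial ring in the variables $x_1,\ldots,x_n$\<close>

text \<open>
  A polynomial is a finitely supported map from exponent vectors to coefficients, with the
  convolution product of the library. The type has variables indexed by all of nat; the carrier
  below consists of the polynomials in which only $x_1,\ldots,x_n$ occur.
\<close>

type_synonym 'k mpoly = "(nat \<Rightarrow>\<^sub>0 nat) \<Rightarrow>\<^sub>0 'k"

definition poly_ring :: "nat \<Rightarrow> ('k::field mpoly) ring" where
  "poly_ring n = \<lparr> carrier = {p. \<forall>m \<in> Poly_Mapping.keys p. Poly_Mapping.keys m \<subseteq> {1..n}},
     mult = (*), one = 1, zero = 0, add = (+) \<rparr>"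

definition var :: "nat \<Rightarrow> 'k::field mpoly" where
  "var i = Poly_Mapping.single (Poly_Mapping.single i 1) 1"

definition const :: "'k \<Rightarrow> 'k::field mpoly" where
  "const c = Poly_Mapping.single 0 c"

definition monom_degree :: "(nat \<Rightarrow>\<^sub>0 nat) \<Rightarrow> nat" where
  "monom_degree m = (\<Sum>i \<in> Poly_Mapping.keys m. Poly_Mapping.lookup m i)"

definition poly_grading :: "nat \<Rightarrow> nat \<Rightarrow> ('k::field mpoly) set" where
  "poly_grading n i =
     {p \<in> carrier (poly_ring n). \<forall>m \<in> Poly_Mapping.keys p. monom_degree m = i}"

lemma poly_ring_cring: "cring (poly_ring n :: ('k::field mpoly) ring)"
proof -
  have add: "p + q \<in> carrier (poly_ring n)"
    if "p \<in> carrier (poly_ring n)" "q \<in> carrier (poly_ring n)" for p q :: "'k mpoly"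
    using that keys_add[of p q] unfolding poly_ring_def by auto
  have mult: "p * q \<in> carrier (poly_ring n)"
    if pq: "p \<in> carrier (poly_ring n)" "q \<in> carrier (poly_ring n)" for p q :: "'k mpoly"
  proof -
    have "Poly_Mapping.keys m \<subseteq> {1..n}" if m: "m \<in> Poly_Mapping.keys (p * q)" for m
    proof -
      obtain a b where "a \<in> Poly_Mapping.keys p" "b \<in> Poly_Mapping.keys q" "m = a + b"
        using m keys_mult[of p q] by auto
      then have "Poly_Mapping.keys a \<subseteq> {1..n}" "Poly_Mapping.keys b \<subseteq> {1..n}"
        using pq unfolding poly_ring_def by auto
      then show ?thesis using keys_add[of a b] \<open>m = a + b\<close> by blast
    qed
    then show ?thesis unfolding poly_ring_def by auto
  qed
  have minus: "- p \<in> carrier (poly_ring n)" if "p \<in> carrier (poly_ring n)" for p :: "'k mpoly"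
    using that unfolding poly_ring_def by simp
  have zero: "(0 :: 'k mpoly) \<in> carrier (poly_ring n)"
    unfolding poly_ring_def by simp
  have one: "(1 :: 'k mpoly) \<in> carrier (poly_ring n)"
    unfolding poly_ring_def single_one[symmetric] by simp
  have ops: "\<zero>\<^bsub>poly_ring n\<^esub> = (0 :: 'k mpoly)" "\<one>\<^bsub>poly_ring n\<^esub> = (1 :: 'k mpoly)"
    "x \<oplus>\<^bsub>poly_ring n\<^esub> y = x + y" "x \<otimes>\<^bsub>poly_ring n\<^esub> y = x * y" for x y :: "'k mpoly"
    by (simp_all add: poly_ring_def)
  show ?thesis
  proof (rule cringI)
    show "abelian_group (poly_ring n :: 'k mpoly ring)"
    proof (rule abelian_groupI, unfold ops)
      fix p :: "'k mpoly"
      assume "p \<in> carrier (poly_ring n)"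
      then show "\<exists>q\<in>carrier (poly_ring n). q + p = 0"
        by (intro bexI[of _ "- p"] minus) simp_all
    qed (rule add zero add.assoc add.commute add_0_left; assumption)+
    show "Group.comm_monoid (poly_ring n :: 'k mpoly ring)"
      by (rule comm_monoidI, unfold ops)
        (rule mult one mult.assoc mult.commute mult_1_left; assumption)+
  qed (unfold ops, rule distrib_right)
qed


section \<open>Graded algebras\<close>

text \<open>
  A standard graded algebra is given by a commutative ring \<open>A\<close> together with the family
  \<open>G\<close> of its homogeneous components; if \<open>A\<close> is nonzero, \<open>G 0\<close> is a copy
  of the ground field.
\<close>

definition quotient_grading ::
    "('a, 'b) ring_scheme \<Rightarrow> (nat \<Rightarrow> 'a set) \<Rightarrow> 'a set \<Rightarrow> nat \<Rightarrow> 'a set set" where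
  "quotient_grading A G I i = (\<lambda>a. I +>\<^bsub>A\<^esub> a) ` G i"

definition strong_lefschetz :: "('a, 'b) ring_scheme \<Rightarrow> (nat \<Rightarrow> 'a set) \<Rightarrow> bool" where
  "strong_lefschetz A G \<longleftrightarrow>
     (\<exists>l \<in> G 1. \<forall>j\<ge>1. \<forall>i.
        inj_on (\<lambda>a. (l [^]\<^bsub>A\<^esub> (j::nat)) \<otimes>\<^bsub>A\<^esub> a) (G i) \<or>
        (\<lambda>a. (l [^]\<^bsub>A\<^esub> j) \<otimes>\<^bsub>A\<^esub> a) ` G i = G (i + j))"

text \<open>The annihilator of the irrelevant maximal ideal, i.e. of all components of positive degree.\<close>

definition socle :: "('a, 'b) ring_scheme \<Rightarrow> (nat \<Rightarrow> 'a set) \<Rightarrow> 'a set" where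
  "socle A G = {a \<in> carrier A. \<forall>i\<ge>1. \<forall>b \<in> G i. b \<otimes>\<^bsub>A\<^esub> a = \<zero>\<^bsub>A\<^esub>}"

text \<open>For an algebra of finite type over a field, being Artinian means having finite dimension.\<close>

definition artinian_gorenstein :: "('a, 'b) ring_scheme \<Rightarrow> (nat \<Rightarrow> 'a set) \<Rightarrow> bool" where
  "artinian_gorenstein A G \<longleftrightarrow>
     (\<exists>N. ring.dimension A N (G 0) (carrier A)) \<and> ring.dimension A 1 (G 0) (socle A G)"

definition regular_sequence :: "('a, 'b) ring_scheme \<Rightarrow> 'a list \<Rightarrow> bool" where
  "regular_sequence A ts \<longleftrightarrow>
     set ts \<subseteq> carrier A \<and>
     (\<forall>i < length ts. \<forall>a \<in> carrier A.
        ts ! i \<otimes>\<^bsub>A\<^esub> a \<in> Idl\<^bsub>A\<^esub> (set (take i ts)) \<longrightarrow> a \<in> Idl\<^bsub>A\<^esub> (set (take i ts))) \<and>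
     Idl\<^bsub>A\<^esub> (set ts) \<noteq> carrier A"

text \<open>
  A graded algebra is Gorenstein if it is Cohen-Macaulay of type 1: some homogeneous regular
  sequence of elements of positive degree has an Artinian quotient with one-dimensional socle.
  If \<open>A\<close> is Artinian, elements of positive degree are nilpotent, so the sequence is empty
  and the condition is that \<open>A\<close> itself has a one-dimensional socle.
\<close>

definition gorenstein :: "('a, 'b) ring_scheme \<Rightarrow> (nat \<Rightarrow> 'a set) \<Rightarrow> bool" where
  "gorenstein A G \<longleftrightarrow>
     (\<exists>ts. (\<forall>t \<in> set ts. \<exists>i\<ge>1. t \<in> G i) \<and> regular_sequence A ts \<and>
        artinian_gorenstein (A Quot (Idl\<^bsub>A\<^esub> (set ts)))
          (quotient_grading A G (Idl\<^bsub>A\<^esub> (set ts))))"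


section \<open>The ideal\<close>

definition K' :: "nat \<Rightarrow> (nat \<Rightarrow> nat) \<Rightarrow> (nat \<Rightarrow> nat) \<Rightarrow> 'k \<Rightarrow> ('k::field mpoly) set" where
  "K' n d \<alpha> c =
     (Idl\<^bsub>poly_ring n\<^esub> ({var 1 ^ d 1 + const c * (\<Prod>i\<in>{2..n}. var i ^ \<alpha> i)} \<union>
        {var i ^ d i | i. i \<in> {2..n}}))
     <+>\<^bsub>poly_ring n\<^esub>
     ((PIdl\<^bsub>poly_ring n\<^esub> (var 1 ^ (d 1 - \<alpha> 1))) \<cdot>\<^bsub>poly_ring n\<^esub>
      (Idl\<^bsub>poly_ring n\<^esub> {var i ^ (d i - \<alpha> i) | i. i \<in> {2..n}}))"

end

theory Submission
  imports Defs "Jordan_Normal_Form.Determinant"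
begin

text \<open>
  Reduction modulo \<open>K'\<close> rewrites \<open>x\<^sub>1\<close> to the power \<open>d\<^sub>1\<close> as \<open>-c\<close> times the monomial with
  exponents \<open>\<alpha>\<^sub>i\<close>. A single functional \<open>\<Phi>\<close>, supported on the monomials that reduce to the top one,
  satisfies \<open>p \<in> K' \<longleftrightarrow> (\<forall>q. \<Phi> (p q) = 0)\<close>; so the quotient is Gorenstein.

  For the strong Lefschetz property it suffices that for some \<open>t\<close> the form \<open>\<Phi> (l\<^sub>t\<^sup>j p q)\<close> with
  \<open>l\<^sub>t = t x\<^sub>1 + x\<^sub>2 + \<dots> + x\<^sub>n\<close> is nondegenerate in each degree \<open>i\<close> with \<open>2 i + j\<close> the socle degree.
  Rescaling \<open>x\<^sub>1\<close> by \<open>t\<close> multiplies \<open>c\<close> by a power of \<open>t\<close>, and after normalisation the determinant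
  is a polynomial in \<open>c\<close>, so only \<open>c = 0\<close> has to be considered. There the quotient is monomial, and it
  is an extension of two monomial complete intersections with the same centre of symmetry. These have
  the strong Lefschetz property by the \<open>sl\<^sub>2\<close> commutator relation.
\<close>

text \<open>The obstacle is that Phi degenerates at c = 0, just where the determinant has to be
  evaluated: a monomial whose x_1-exponent is at least d_1 - \<alpha>_1 (\<open>late\<close>) pairs
  with its complement only at level 2, with value -c. Every row indexed by a late monomial is
  divisible by c, and dividing it out is the normalisation; the limit is the matrix of
  multiplication by a power of x_1 + ... + x_n on the monomial quotient. The equality of d_1 with
  the sum \<alpha>_2 + ... + \<alpha>_n enters twice. It gives all levels the same degree. It also
  centres the box with sides d_1 - \<alpha>_1, d_2, ..., d_n and the box with sides \<alpha>_1, d_2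
  - \<alpha>_2, ..., d_n - \<alpha>_n, shifted by x_1^(d_1 - \<alpha>_1), at the same degree, so
  that injectivity on both passes to the extension. For d_1 = 0 the quotient is not Artinian: all
  \<alpha>_i vanish, properness forces c = -1, and x_1 is a nonzerodivisor that is itself a
  Lefschetz element and has a monomial complete intersection as quotient.\<close>

abbreviation (input) "lookup \<equiv> Poly_Mapping.lookup"
abbreviation (input) "keys \<equiv> Poly_Mapping.keys"
abbreviation (input) "single \<equiv> Poly_Mapping.single"

section \<open>Monomials and linear functionals\<close>

definition monoms :: "nat \<Rightarrow> (nat \<Rightarrow>\<^sub>0 nat) set" where
  "monoms n = {m. keys m \<subseteq> {1..n}}"

definition lin :: "((nat \<Rightarrow>\<^sub>0 nat) \<Rightarrow> 'k) \<Rightarrow> 'k mpoly \<Rightarrow> 'k::field" where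
  "lin w p = (\<Sum>m\<in>keys p. lookup p m * w m)"

lemma lin_superset:
  "finite A \<Longrightarrow> keys p \<subseteq> A \<Longrightarrow> lin w p = (\<Sum>m\<in>A. lookup p m * w m)"
  unfolding lin_def by (rule sum.mono_neutral_left) (auto simp: in_keys_iff)

lemma lin_add: "lin w (p + q) = lin w p + lin w q"
proof -
  have "lin w r = (\<Sum>m\<in>keys p \<union> keys q. lookup r m * w m)"
    if "r \<in> {p, q, p + q}" for r
    using that keys_add[of p q] by (intro lin_superset) auto
  then show ?thesis by (simp add: lookup_add distrib_right sum.distrib)
qed

lemma lin_0 [simp]: "lin w 0 = 0"
  by (simp add: lin_def)

lemma lin_single [simp]: "lin w (single m a) = a * w m"
  by (cases "a = 0") (simp_all add: lin_def)

lemma lin_sum: "lin w (sum f A) = (\<Sum>x\<in>A. lin w (f x))"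
  by (induction A rule: infinite_finite_induct) (simp_all add: lin_add)

lemma lin_cong: "(\<And>m. m \<in> keys p \<Longrightarrow> w m = v m) \<Longrightarrow> lin w p = lin v p"
  by (simp add: lin_def)

lemma sum_single: "p = (\<Sum>m\<in>keys p. single m (lookup p m))"
  by (rule poly_mapping_eqI)
    (auto simp: lookup_sum lookup_single when_def sum.delta' in_keys_iff)

lemma single_times: "single a c * p = (\<Sum>m\<in>keys p. single (a + m) (c * lookup p m))"
  by (subst (1) sum_single[of p]) (simp add: sum_distrib_left mult_single)

text \<open>Multiplying by a monomial only shifts the weights, so Phi(x^m p) = 0 can be stated as
  \<open>lin (\<lambda>k. w (m + k)) p = 0\<close> without forming the product.\<close>

lemma lin_single_times: "lin w (single a c * p) = c * lin (\<lambda>m. w (a + m)) p"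
  by (simp add: single_times lin_sum) (simp add: lin_def sum_distrib_left mult.assoc)

lemma lookup_eq_lin: "lookup p k = lin (\<lambda>m. of_bool (m = k)) p"
  by (auto simp: lin_def of_bool_def in_keys_iff if_distrib sum.delta' cong: if_cong)

lemma lookup_single_times:
  fixes p :: "'k::field mpoly"
  shows "lookup (single a c * p) (a + k) = c * lookup p k"
  by (simp add: lookup_eq_lin lin_single_times)

lemma lookup_single_times_eq_0:
  fixes p :: "'k::field mpoly"
  assumes "\<And>b. k \<noteq> a + b"
  shows "lookup (single a c * p) k = 0"
  using assms[symmetric] by (simp add: lookup_eq_lin lin_single_times) (simp add: lin_def)

lemma monoms_0 [simp]: "0 \<in> monoms n"
  by (simp add: monoms_def)

lemma monoms_add [simp]: "a + b \<in> monoms n \<longleftrightarrow> a \<in> monoms n \<and> b \<in> monoms n"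
proof -
  have "keys (a + b) = keys a \<union> keys b"
    by (auto simp: in_keys_iff lookup_add)
  then show ?thesis by (simp add: monoms_def)
qed

lemma monoms_single [simp]: "i \<in> {1..n} \<Longrightarrow> single i k \<in> monoms n"
  by (simp add: monoms_def)

lemma monoms_sum: "(\<And>i. i \<in> A \<Longrightarrow> f i \<in> monoms n) \<Longrightarrow> sum f A \<in> monoms n"
  by (induction A rule: infinite_finite_induct) simp_all

lemma lookup_monoms: "m \<in> monoms n \<Longrightarrow> i \<notin> {1..n} \<Longrightarrow> lookup m i = 0"
  by (auto simp: monoms_def in_keys_iff)

lemma monoms_eqI:
  assumes "a \<in> monoms n" "b \<in> monoms n" "\<And>i. i \<in> {1..n} \<Longrightarrow> lookup a i = lookup b i"
  shows "a = b"
  by (rule poly_mapping_eqI) (metis assms lookup_monoms)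

text \<open>Divisibility of monomials: subtraction of exponents truncates, so \<open>b - a\<close>
  is a true quotient only under the componentwise bound.\<close>

lemma monoms_le:
  assumes "b \<in> monoms n" "\<And>i. i \<in> {1..n} \<Longrightarrow> lookup a i \<le> lookup b i" "a \<in> monoms n"
  shows "b = a + (b - a)"
  by (rule poly_mapping_eqI)
    (metis assms lookup_monoms le_add_diff_inverse lookup_add lookup_minus order_refl)

lemma monoms_diff [simp]: "b \<in> monoms n \<Longrightarrow> b - a \<in> monoms n"
  by (auto simp: monoms_def in_keys_iff lookup_minus subset_iff)

lemma monom_degree_superset:
  "finite A \<Longrightarrow> keys m \<subseteq> A \<Longrightarrow> monom_degree m = (\<Sum>i\<in>A. lookup m i)"
  unfolding monom_degree_def by (rule sum.mono_neutral_left) (auto simp: in_keys_iff)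

lemma monom_degree_monoms: "m \<in> monoms n \<Longrightarrow> monom_degree m = (\<Sum>i\<in>{1..n}. lookup m i)"
  by (rule monom_degree_superset) (auto simp: monoms_def)

lemma monom_degree_add [simp]: "monom_degree (a + b) = monom_degree a + monom_degree b"
proof -
  have "monom_degree r = (\<Sum>i\<in>keys a \<union> keys b. lookup r i)" if "r \<in> {a, b, a + b}" for r
    using that keys_add[of a b] by (intro monom_degree_superset) auto
  then show ?thesis by (simp add: lookup_add sum.distrib)
qed

lemma monom_degree_0 [simp]: "monom_degree 0 = 0"
  by (simp add: monom_degree_def)

lemma monom_degree_single [simp]: "monom_degree (single i k) = k"
  by (cases "k = 0") (simp_all add: monom_degree_def)

lemma monom_degree_sum: "monom_degree (sum f A) = (\<Sum>x\<in>A. monom_degree (f x))"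
  by (induction A rule: infinite_finite_induct) simp_all

lemma monom_degree_eq_0: "monom_degree m = 0 \<longleftrightarrow> m = 0"
proof
  assume "monom_degree m = 0"
  then have "lookup m i = 0" for i
    by (cases "i \<in> keys m") (simp_all add: monom_degree_def in_keys_iff)
  then show "m = 0" by (intro poly_mapping_eqI) simp
qed simp

lemma var_pow: "var i ^ k = (single (single i k) 1 :: 'k::field mpoly)"
proof (induction k)
  case (Suc k)
  then show ?case by (simp add: var_def mult_single flip: single_add)
qed simp

lemma prod_var_pow:
  "finite A \<Longrightarrow> (\<Prod>i\<in>A. var i ^ f i) = (single (\<Sum>i\<in>A. single i (f i)) 1 :: 'k::field mpoly)"
  by (induction A rule: finite_induct) (simp_all add: var_pow mult_single)

section \<open>The polynomial ring and its ideals\<close>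

lemma poly_ring_simps [simp]:
  "monoid.mult (poly_ring n) = (*)" "one (poly_ring n) = 1" "zero (poly_ring n) = 0"
  "add (poly_ring n) = (+)"
  by (simp_all add: poly_ring_def)

lemma carrier_poly_ring: "p \<in> carrier (poly_ring n) \<longleftrightarrow> keys p \<subseteq> monoms n"
  by (auto simp: poly_ring_def monoms_def)

interpretation poly_ring: cring "poly_ring n :: 'k::field mpoly ring" for n
  by (rule poly_ring_cring)

lemma carrier_poly_ring_closed [simp, intro]:
  fixes p q :: "'k::field mpoly"
  shows "0 \<in> carrier (poly_ring n)" "1 \<in> carrier (poly_ring n)"
    and "p \<in> carrier (poly_ring n) \<Longrightarrow> q \<in> carrier (poly_ring n) \<Longrightarrow> p + q \<in> carrier (poly_ring n)"
    and "p \<in> carrier (poly_ring n) \<Longrightarrow> q \<in> carrier (poly_ring n) \<Longrightarrow> p * q \<in> carrier (poly_ring n)"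
  using poly_ring.zero_closed[of n] poly_ring.one_closed[of n]
    poly_ring.add.m_closed[of p n q] poly_ring.m_closed[of p n q] by simp_all

lemma single_carrier [simp]: "m \<in> monoms n \<Longrightarrow> single m a \<in> carrier (poly_ring n)"
  by (simp add: carrier_poly_ring)

lemma uminus_carrier [simp]: "p \<in> carrier (poly_ring n) \<Longrightarrow> - p \<in> carrier (poly_ring n)"
  by (simp add: carrier_poly_ring)

lemma diff_carrier [simp]:
  "p \<in> carrier (poly_ring n) \<Longrightarrow> q \<in> carrier (poly_ring n) \<Longrightarrow> p - q \<in> carrier (poly_ring n)"
  unfolding diff_conv_add_uminus by (intro carrier_poly_ring_closed uminus_carrier)

lemma power_carrier [simp]: "p \<in> carrier (poly_ring n) \<Longrightarrow> p ^ k \<in> carrier (poly_ring n)"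
  by (induction k) auto

text \<open>Terms suffice for absorption because a polynomial is the finite sum of its terms;
  negation is multiplication by the term -1.\<close>

lemma ideal_poly_ringI:
  fixes I :: "'k::field mpoly set"
  assumes sub: "I \<subseteq> carrier (poly_ring n)" and zero: "0 \<in> I"
    and add: "\<And>p q. p \<in> I \<Longrightarrow> q \<in> I \<Longrightarrow> p + q \<in> I"
    and mult: "\<And>p m a. p \<in> I \<Longrightarrow> m \<in> monoms n \<Longrightarrow> single m a * p \<in> I"
  shows "ideal I (poly_ring n)"
proof (rule idealI)
  have mult': "q * p \<in> I" if "p \<in> I" "q \<in> carrier (poly_ring n)" for p q
  proof -
    have "(\<Sum>m\<in>A. single m (lookup q m) * p) \<in> I" if "finite A" "A \<subseteq> keys q" for A
      using that \<open>p \<in> I\<close> \<open>q \<in> carrier (poly_ring n)\<close>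
      by (induction A rule: finite_induct) (auto simp: zero carrier_poly_ring intro!: add mult)
    then have "(\<Sum>m\<in>keys q. single m (lookup q m)) * p \<in> I"
      by (simp add: sum_distrib_right)
    then show ?thesis by (simp flip: sum_single)
  qed
  show "subgroup I (add_monoid (poly_ring n))"
  proof (rule poly_ring.add.subgroupI)
    fix p assume "p \<in> I"
    then have "(- 1) * p \<in> I" by (intro mult') auto
    moreover have "\<ominus>\<^bsub>poly_ring n\<^esub> p = - p"
      using \<open>p \<in> I\<close> sub by (intro poly_ring.minus_equality) auto
    ultimately show "\<ominus>\<^bsub>poly_ring n\<^esub> p \<in> I" by simp
  qed (use sub zero add in auto)
  show "q \<otimes>\<^bsub>poly_ring n\<^esub> p \<in> I" "p \<otimes>\<^bsub>poly_ring n\<^esub> q \<in> I"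
    if "p \<in> I" "q \<in> carrier (poly_ring n)" for p q
    using mult'[OF that] by (simp_all add: mult.commute)
qed (rule poly_ring.ring_axioms)

context
  fixes I :: "'k::field mpoly set" and n :: nat
  assumes I: "ideal I (poly_ring n)"
begin

lemma poly_ideal_carrier: "p \<in> I \<Longrightarrow> p \<in> carrier (poly_ring n)"
  using ideal.Icarr[OF I] .

lemma poly_ideal_0: "0 \<in> I"
  using additive_subgroup.zero_closed[OF ideal.axioms(1)[OF I]] by simp

lemma poly_ideal_add: "p \<in> I \<Longrightarrow> q \<in> I \<Longrightarrow> p + q \<in> I"
  using additive_subgroup.a_closed[OF ideal.axioms(1)[OF I], of p q] by simp

lemma poly_ideal_mult: "p \<in> I \<Longrightarrow> q \<in> carrier (poly_ring n) \<Longrightarrow> q * p \<in> I"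
  using ideal.I_l_closed[OF I, of p q] by simp

lemma poly_ideal_uminus: "p \<in> I \<Longrightarrow> - p \<in> I"
  using poly_ideal_mult[of p "- 1"] by simp

lemma poly_ideal_diff: "p \<in> I \<Longrightarrow> q \<in> I \<Longrightarrow> p - q \<in> I"
  using poly_ideal_add[of p "- q"] poly_ideal_uminus by simp

lemma poly_ideal_sum: "(\<And>x. x \<in> A \<Longrightarrow> f x \<in> I) \<Longrightarrow> sum f A \<in> I"
  by (induction A rule: infinite_finite_induct) (auto simp: poly_ideal_0 poly_ideal_add)

end

section \<open>Generators and minimality of the ideal K'\<close>

lemma set_add_poly_ring: "A <+>\<^bsub>poly_ring n\<^esub> B = {p + q | p q. p \<in> A \<and> q \<in> B}"
  by (auto simp: set_add_def set_mult_def)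

lemma var_carrier [simp]: "i \<in> {1..n} \<Longrightarrow> var i \<in> carrier (poly_ring n)"
  by (simp add: var_def)

text \<open>The exponents \<open>k\<close> stay arbitrary in order to cover both \<open>d i\<close>
  and \<open>d i - \<alpha> i\<close>.\<close>

lemma K'_generators_carrier:
  assumes "n \<ge> 1"
  shows "var 1 ^ d 1 + const c * (\<Prod>i\<in>{2..n}. var i ^ \<alpha> i) \<in> carrier (poly_ring n :: 'k::field mpoly ring)"
    and "{var i ^ k i | i. i \<in> {2..n}} \<subseteq> carrier (poly_ring n :: 'k mpoly ring)"
    and "var 1 ^ k 1 \<in> carrier (poly_ring n :: 'k mpoly ring)"
  using assms
  by (auto simp: prod_var_pow const_def
      intro!: carrier_poly_ring_closed(3,4) single_carrier monoms_sum)

context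
  fixes n :: nat and d \<alpha> :: "nat \<Rightarrow> nat" and c :: "'k::field"
  assumes n: "n \<ge> 1"
begin

lemma K'_ideal: "ideal (K' n d \<alpha> c) (poly_ring n)"
  unfolding K'_def using K'_generators_carrier[OF n]
  by (intro poly_ring.add_ideals poly_ring.ideal_prod_is_ideal poly_ring.genideal_ideal
      poly_ring.cgenideal_ideal) auto

lemma K'_left:
  assumes "p \<in> {var 1 ^ d 1 + const c * (\<Prod>i\<in>{2..n}. var i ^ \<alpha> i)} \<union> {var i ^ d i | i. i \<in> {2..n}}"
  shows "p \<in> K' n d \<alpha> c"
proof -
  let ?G = "{var 1 ^ d 1 + const c * (\<Prod>i\<in>{2..n}. var i ^ \<alpha> i)} \<union> {var i ^ d i | i. i \<in> {2..n}}"
  let ?B = "{var i ^ (d i - \<alpha> i) | i. i \<in> {2..n}} :: 'k mpoly set"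
  let ?P = "(PIdl\<^bsub>poly_ring n\<^esub> (var 1 ^ (d 1 - \<alpha> 1))) \<cdot>\<^bsub>poly_ring n\<^esub> (Idl\<^bsub>poly_ring n\<^esub> ?B)"
  have "p \<in> Idl\<^bsub>poly_ring n\<^esub> ?G"
    using assms poly_ring.genideal_self[of ?G n] K'_generators_carrier[OF n] by blast
  moreover have "ideal ?P (poly_ring n)"
    using K'_generators_carrier[OF n]
    by (intro poly_ring.ideal_prod_is_ideal poly_ring.genideal_ideal poly_ring.cgenideal_ideal) auto
  then have "0 \<in> ?P" by (rule poly_ideal_0)
  ultimately have "p + 0 \<in> K' n d \<alpha> c"
    unfolding K'_def set_add_poly_ring by blast
  then show ?thesis by simp
qed

lemma K'_pow: "i \<in> {2..n} \<Longrightarrow> var i ^ d i \<in> K' n d \<alpha> c"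
  by (rule K'_left) blast

lemma K'_right:
  assumes "i \<in> {2..n}"
  shows "var 1 ^ (d 1 - \<alpha> 1) * var i ^ (d i - \<alpha> i) \<in> K' n d \<alpha> c"
proof -
  let ?G = "{var 1 ^ d 1 + const c * (\<Prod>i\<in>{2..n}. var i ^ \<alpha> i)} \<union> {var i ^ d i | i. i \<in> {2..n}}"
  let ?B = "{var i ^ (d i - \<alpha> i) | i. i \<in> {2..n}} :: 'k mpoly set"
  let ?a = "var 1 ^ (d 1 - \<alpha> 1) :: 'k mpoly"
  have "?a \<in> PIdl\<^bsub>poly_ring n\<^esub> ?a"
    using n by (intro poly_ring.cgenideal_self) simp
  moreover have "var i ^ (d i - \<alpha> i) \<in> Idl\<^bsub>poly_ring n\<^esub> ?B"
    using assms
    by (intro subsetD[OF poly_ring.genideal_self[OF K'_generators_carrier(2)[OF n]]]) auto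
  ultimately have "?a * var i ^ (d i - \<alpha> i)
      \<in> (PIdl\<^bsub>poly_ring n\<^esub> ?a) \<cdot>\<^bsub>poly_ring n\<^esub> (Idl\<^bsub>poly_ring n\<^esub> ?B)"
    using ideal_prod.prod[of ?a _ _ _ "poly_ring n"] by simp
  moreover have "ideal (Idl\<^bsub>poly_ring n\<^esub> ?G) (poly_ring n)"
    using K'_generators_carrier[OF n] by (intro poly_ring.genideal_ideal) auto
  then have "0 \<in> Idl\<^bsub>poly_ring n\<^esub> ?G" by (rule poly_ideal_0)
  ultimately have "0 + ?a * var i ^ (d i - \<alpha> i) \<in> K' n d \<alpha> c"
    unfolding K'_def set_add_poly_ring by blast
  then show ?thesis by simp
qed

text \<open>With \<open>K'_left\<close> and \<open>K'_right\<close> this describes K' by finitely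
  many generators, so later arguments never open the product of ideals.\<close>

lemma K'_least:
  assumes I: "ideal I (poly_ring n)"
    and 1: "var 1 ^ d 1 + const c * (\<Prod>i\<in>{2..n}. var i ^ \<alpha> i) \<in> I"
    and 2: "\<And>i. i \<in> {2..n} \<Longrightarrow> var i ^ d i \<in> I"
    and 3: "\<And>i. i \<in> {2..n} \<Longrightarrow> var 1 ^ (d 1 - \<alpha> 1) * var i ^ (d i - \<alpha> i) \<in> I"
  shows "K' n d \<alpha> c \<subseteq> I"
proof -
  let ?G = "{var 1 ^ d 1 + const c * (\<Prod>i\<in>{2..n}. var i ^ \<alpha> i)} \<union> {var i ^ d i | i. i \<in> {2..n}}"
  let ?B = "{var i ^ (d i - \<alpha> i) | i. i \<in> {2..n}} :: 'k mpoly set"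
  let ?a = "var 1 ^ (d 1 - \<alpha> 1) :: 'k mpoly"
  have a: "?a \<in> carrier (poly_ring n)" using n by simp
  have G: "Idl\<^bsub>poly_ring n\<^esub> ?G \<subseteq> I"
    using 1 2 by (intro poly_ring.genideal_minimal[OF I]) auto
  \<comment> \<open>The colon ideal of I by x_1^(d_1 - \<alpha>_1): it contains the generators of
    the second factor, hence that whole factor.\<close>
  have "ideal {p \<in> carrier (poly_ring n). ?a * p \<in> I} (poly_ring n)"
  proof (rule ideal_poly_ringI)
    fix p :: "'k mpoly" and m b
    assume "p \<in> {p \<in> carrier (poly_ring n). ?a * p \<in> I}" "m \<in> monoms n"
    then show "single m b * p \<in> {p \<in> carrier (poly_ring n). ?a * p \<in> I}"
      using poly_ideal_mult[OF I, of "?a * p" "single m b"] by (auto simp: mult.left_commute)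
  qed (auto simp: poly_ideal_0[OF I] distrib_left intro: poly_ideal_add[OF I])
  then have B: "Idl\<^bsub>poly_ring n\<^esub> ?B \<subseteq> {p \<in> carrier (poly_ring n). ?a * p \<in> I}"
    using 3 K'_generators_carrier(2)[OF n, of "\<lambda>i. d i - \<alpha> i"]
    by (intro poly_ring.genideal_minimal) auto
  have "p \<in> I" if "p \<in> (PIdl\<^bsub>poly_ring n\<^esub> ?a) \<cdot>\<^bsub>poly_ring n\<^esub> (Idl\<^bsub>poly_ring n\<^esub> ?B)" for p
    using that
  proof induction
    case (prod i j)
    then obtain x where x: "x \<in> carrier (poly_ring n)" "i = x * ?a"
      by (auto simp: cgenideal_def)
    have "?a * j \<in> I" using B prod by auto
    from poly_ideal_mult[OF I this x(1)] show ?case by (simp add: x mult.assoc)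
  qed (simp add: poly_ideal_add[OF I])
  with G show ?thesis
    unfolding K'_def set_add_poly_ring by (blast intro: poly_ideal_add[OF I])
qed

end

section \<open>The strong Lefschetz property of monomial complete intersections\<close>

text \<open>Exponents of the monomial basis of the complete intersection with relations
  x_i^(e_i).\<close>

definition box :: "nat \<Rightarrow> (nat \<Rightarrow> nat) \<Rightarrow> (nat \<Rightarrow>\<^sub>0 nat) set" where
  "box n e = {m \<in> monoms n. \<forall>i\<in>{1..n}. lookup m i < e i}"

abbreviation (input) unit_exp :: "nat \<Rightarrow> nat \<Rightarrow>\<^sub>0 nat" where
  "unit_exp k \<equiv> single k (Suc 0)"

lemma exp_shift [simp]:
  fixes m :: "nat \<Rightarrow>\<^sub>0 nat"
  shows "m + unit_exp k - unit_exp k = m"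
    and "lookup m k > 0 \<Longrightarrow> m - unit_exp k + unit_exp k = m"
    and "k \<noteq> l \<Longrightarrow> m + unit_exp k - unit_exp l = m - unit_exp l + unit_exp k"
  by (rule poly_mapping_eqI; auto simp: lookup_add lookup_minus lookup_single when_def)+

text \<open>The truncated algebra is modelled by coefficient functions vanishing outside the box;
  the dummy \<open>ty\<close> fixes the coefficient field.\<close>

locale monomial_box =
  fixes n :: nat and e :: "nat \<Rightarrow> nat" and ty :: "'k::field_char_0 itself"
begin

text \<open>Multiplication by x_k modulo the powers x_i^(e_i), read on coefficients.\<close>

definition up :: "nat \<Rightarrow> ((nat \<Rightarrow>\<^sub>0 nat) \<Rightarrow> 'k) \<Rightarrow> (nat \<Rightarrow>\<^sub>0 nat) \<Rightarrow> 'k" where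
  "up k f m = (if m \<in> box n e \<and> lookup m k > 0 then f (m - unit_exp k) else 0)"

text \<open>The coefficients of \<open>down\<close> are those of the irreducible \<open>sl\<^sub>2\<close>-module of dimension \<open>e k\<close>.\<close>

definition down :: "nat \<Rightarrow> ((nat \<Rightarrow>\<^sub>0 nat) \<Rightarrow> 'k) \<Rightarrow> (nat \<Rightarrow>\<^sub>0 nat) \<Rightarrow> 'k" where
  "down k f m = (if m \<in> box n e
     then of_nat ((lookup m k + 1) * (e k - lookup m k - 1)) * f (m + unit_exp k) else 0)"

definition raise :: "((nat \<Rightarrow>\<^sub>0 nat) \<Rightarrow> 'k) \<Rightarrow> (nat \<Rightarrow>\<^sub>0 nat) \<Rightarrow> 'k" where
  "raise f m = (\<Sum>k\<in>{1..n}. up k f m)"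

definition lower :: "((nat \<Rightarrow>\<^sub>0 nat) \<Rightarrow> 'k) \<Rightarrow> (nat \<Rightarrow>\<^sub>0 nat) \<Rightarrow> 'k" where
  "lower f m = (\<Sum>k\<in>{1..n}. down k f m)"

definition homogeneous :: "nat \<Rightarrow> ((nat \<Rightarrow>\<^sub>0 nat) \<Rightarrow> 'k) \<Rightarrow> bool" where
  "homogeneous i f \<longleftrightarrow> (\<forall>m. f m \<noteq> 0 \<longrightarrow> m \<in> box n e \<and> monom_degree m = i)"

text \<open>The eigenvalue on degree i of the commutator of \<open>lower\<close> and
  \<open>raise\<close>; an integer, since it turns negative past the middle degree.\<close>

definition weight :: "nat \<Rightarrow> int" where
  "weight i = (\<Sum>k\<in>{1..n}. int (e k) - 1) - 2 * int i"

lemma box_minus: "m \<in> box n e \<Longrightarrow> m - unit_exp k \<in> box n e"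
  by (auto simp: box_def lookup_minus intro: le_less_trans[OF diff_le_self])

lemma box_plus:
  "m \<in> box n e \<Longrightarrow> k \<in> {1..n} \<Longrightarrow> m + unit_exp k \<in> box n e \<longleftrightarrow> lookup m k + 1 < e k"
  by (auto simp: box_def lookup_add lookup_single when_def)

lemma down_up_commute: "k \<in> {1..n} \<Longrightarrow> k \<noteq> l \<Longrightarrow> down k (up l f) m = up l (down k f) m"
proof (cases "m \<in> box n e \<and> lookup m k + 1 < e k")
  case True
  moreover assume "k \<in> {1..n}" "k \<noteq> l"
  ultimately show ?thesis
    by (auto simp: down_def up_def box_plus box_minus lookup_add lookup_minus lookup_single_not_eq)
next
  case False
  \<comment> \<open>On the upper face of the box the coefficient of \<open>down\<close> vanishes, so
    stepping out of the box contributes nothing.\<close>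
  then have 0: "m \<in> box n e \<Longrightarrow> e k - lookup m k - 1 = 0" by simp
  assume "k \<noteq> l"
  with 0 show ?thesis
    by (simp del: of_nat_diff diff_is_0_eq add: down_def up_def lookup_minus lookup_single_not_eq)
qed

text \<open>With a = \<open>lookup m k\<close> and e = \<open>e k\<close> this is (a + 1)(e - a - 1)
  - a(e - a) = e - 1 - 2a.\<close>

lemma down_up:
  assumes "k \<in> {1..n}" "m \<in> box n e"
  shows "down k (up k f) m = up k (down k f) m + of_int (int (e k) - 1 - 2 * int (lookup m k)) * f m"
proof -
  have lt: "lookup m k < e k" using assms by (auto simp: box_def)
  have 1: "down k (up k f) m = of_int ((int (lookup m k) + 1) * (int (e k) - int (lookup m k) - 1)) * f m"
  proof (cases "lookup m k + 1 < e k")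
    case True
    obtain r where "e k = Suc (lookup m k + r)"
      using lt unfolding less_iff_Suc_add by blast
    then have "int ((lookup m k + 1) * (e k - lookup m k - 1))
        = (int (lookup m k) + 1) * (int (e k) - int (lookup m k) - 1)"
      by (simp add: algebra_simps)
    then have "(of_nat ((lookup m k + 1) * (e k - lookup m k - 1)) :: 'k)
        = of_int ((int (lookup m k) + 1) * (int (e k) - int (lookup m k) - 1))"
      by (metis of_int_of_nat_eq)
    with True assms show ?thesis
      by (simp add: down_def up_def box_plus lookup_add)
  next
    case False
    with lt have "e k = lookup m k + 1" by simp
    then show ?thesis by (simp add: down_def)
  qed
  have 2: "up k (down k f) m = of_int (int (lookup m k) * (int (e k) - int (lookup m k))) * f m"
  proof (cases "lookup m k > 0")
    case True
    have "lookup m k - Suc 0 + 1 = lookup m k" "e k - (lookup m k - Suc 0) - 1 = e k - lookup m k"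
      using True lt by auto
    moreover have "(of_nat (e k - lookup m k) :: 'k) = of_int (int (e k) - int (lookup m k))"
      using lt by (simp add: of_nat_diff)
    ultimately show ?thesis using True assms
      by (simp add: down_def up_def box_minus lookup_minus)
  next
    case False
    then show ?thesis by (simp add: up_def)
  qed
  show ?thesis unfolding 1 2 distrib_right[symmetric] of_int_add[symmetric]
    by (simp add: algebra_simps)
qed

lemma up_sum: "up k (\<lambda>m. \<Sum>x\<in>A. f x m) m = (\<Sum>x\<in>A. up k (f x) m)"
  by (auto simp: up_def)

lemma down_sum: "down k (\<lambda>m. \<Sum>x\<in>A. f x m) m = (\<Sum>x\<in>A. down k (f x) m)"
  by (simp add: down_def sum_distrib_left)

lemma raise_linear: "raise (\<lambda>m. f m + a * g m) m = raise f m + a * raise g m"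
  by (simp add: raise_def up_def sum_distrib_left sum.distrib[symmetric])
    (intro sum.cong, auto)

lemma raise_0 [simp]: "raise (\<lambda>_. 0) = (\<lambda>_. 0)"
  by (auto simp: raise_def up_def)

lemma raise_power_0 [simp]: "(raise ^^ j) (\<lambda>_. 0) = (\<lambda>_. 0)"
  by (induction j) auto

lemma lower_0 [simp]: "lower (\<lambda>_. 0) = (\<lambda>_. 0)"
  by (rule ext) (auto simp: lower_def down_def intro!: sum.neutral)

lemma homogeneousD: "homogeneous i f \<Longrightarrow> f m \<noteq> 0 \<Longrightarrow> m \<in> box n e"
  "homogeneous i f \<Longrightarrow> f m \<noteq> 0 \<Longrightarrow> monom_degree m = i"
  by (auto simp: homogeneous_def)

lemma homogeneous_raise:
  assumes "homogeneous i f"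
  shows "homogeneous (Suc i) (raise f)"
  unfolding homogeneous_def
proof (intro allI impI)
  fix m assume "raise f m \<noteq> 0"
  then obtain k where k: "k \<in> {1..n}" "up k f m \<noteq> 0"
    unfolding raise_def by (meson sum.neutral)
  then have m: "m \<in> box n e" "lookup m k > 0" "f (m - unit_exp k) \<noteq> 0"
    by (auto simp: up_def split: if_splits)
  then have "monom_degree (m - unit_exp k) = i" using homogeneousD(2)[OF assms] by blast
  moreover have "monom_degree m = monom_degree (m - unit_exp k + unit_exp k)" using m by simp
  ultimately show "m \<in> box n e \<and> monom_degree m = Suc i"
    using m(1) unfolding monom_degree_add by simp
qed

lemma homogeneous_raise_power: "homogeneous i f \<Longrightarrow> homogeneous (i + j) ((raise ^^ j) f)"
  by (induction j) (simp_all add: homogeneous_raise)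

lemma lower_nonzero:
  assumes "homogeneous i f" "lower f m \<noteq> 0"
  shows "m \<in> box n e" "Suc (monom_degree m) = i"
proof -
  obtain k where k: "k \<in> {1..n}" "down k f m \<noteq> 0"
    using assms(2) unfolding lower_def by (meson sum.neutral)
  then show "m \<in> box n e" by (auto simp: down_def split: if_splits)
  have "f (m + unit_exp k) \<noteq> 0" using k by (auto simp: down_def split: if_splits)
  then have "monom_degree (m + unit_exp k) = i" using homogeneousD(2)[OF assms(1)] by blast
  then show "Suc (monom_degree m) = i" by simp
qed

lemma lower_raise:
  assumes "homogeneous i f"
  shows "lower (raise f) m = raise (lower f) m + of_int (weight i) * f m"
proof (cases "m \<in> box n e")
  case True
  have "lower (raise f) m = (\<Sum>k\<in>{1..n}. \<Sum>l\<in>{1..n}. down k (up l f) m)"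
    by (simp add: lower_def raise_def[abs_def] down_sum)
  \<comment> \<open>Only the diagonal terms k = l fail to commute.\<close>
  also have "\<dots> = (\<Sum>k\<in>{1..n}. \<Sum>l\<in>{1..n}. up l (down k f) m +
      (if l = k then of_int (int (e k) - 1 - 2 * int (lookup m k)) * f m else 0))"
    using True by (intro sum.cong refl) (auto simp: down_up down_up_commute)
  also have "\<dots> = raise (lower f) m
      + (\<Sum>k\<in>{1..n}. of_int (int (e k) - 1 - 2 * int (lookup m k)) * f m)"
    by (simp add: sum.distrib raise_def lower_def[abs_def] up_sum)
       (rule sum.swap)
  also have "(\<Sum>k\<in>{1..n}. of_int (int (e k) - 1 - 2 * int (lookup m k)) * f m)
      = of_int (\<Sum>k\<in>{1..n}. int (e k) - 1 - 2 * int (lookup m k)) * f m"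
    by (simp only: of_int_sum sum_distrib_right)
  \<comment> \<open>The diagonal terms add up to \<open>weight i\<close> because
    \<open>f m \<noteq> 0\<close> forces m to have degree i.\<close>
  also have "\<dots> = of_int (weight i) * f m"
  proof (cases "f m = 0")
    case False
    then have "m \<in> monoms n" "monom_degree m = i"
      using homogeneousD[OF assms False] by (auto simp: box_def)
    then have "i = (\<Sum>k\<in>{1..n}. lookup m k)"
      by (simp add: monom_degree_monoms)
    then have "(\<Sum>k\<in>{1..n}. int (e k) - 1 - 2 * int (lookup m k)) = weight i"
      by (simp add: weight_def sum_subtractf sum_distrib_left)
    then show ?thesis by simp
  qed simp
  finally show ?thesis .
next
  case False
  then show ?thesis
    using homogeneousD(1)[OF assms] by (auto simp: lower_def raise_def down_def up_def)
qed

text \<open>Moving \<open>lower\<close> past the k + 1 factors costs w, w - 2, ..., w - 2k in turn,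
  where w = \<open>weight i\<close>; the sum is (k + 1)(w - k).\<close>

lemma lower_raise_power:
  assumes "homogeneous i f"
  shows "lower ((raise ^^ Suc k) f)
    = (\<lambda>m. (raise ^^ Suc k) (lower f) m + of_int ((int k + 1) * (weight i - int k)) * (raise ^^ k) f m)"
proof (induction k)
  case 0
  then show ?case using lower_raise[OF assms] by (simp add: fun_eq_iff)
next
  case (Suc k)
  have w: "weight (i + Suc k) = weight i - 2 * int (Suc k)"
    by (simp add: weight_def)
  show ?case
  proof
    fix m
    have "lower ((raise ^^ Suc (Suc k)) f) m = raise (lower ((raise ^^ Suc k) f)) m
        + of_int (weight (i + Suc k)) * (raise ^^ Suc k) f m"
      using lower_raise[OF homogeneous_raise_power[OF assms, of "Suc k"]] by simp
    also have "\<dots> = (raise ^^ Suc (Suc k)) (lower f) m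
        + (of_int ((int k + 1) * (weight i - int k)) + of_int (weight (i + Suc k))) * (raise ^^ Suc k) f m"
      unfolding Suc raise_linear by (simp add: algebra_simps)
    also have "(of_int ((int k + 1) * (weight i - int k)) + of_int (weight (i + Suc k)) :: 'k)
        = of_int ((int (Suc k) + 1) * (weight i - int (Suc k)))"
      unfolding w of_int_add[symmetric] by (simp add: algebra_simps)
    finally show "lower ((raise ^^ Suc (Suc k)) f) m = (raise ^^ Suc (Suc k)) (lower f) m
        + of_int ((int (Suc k) + 1) * (weight i - int (Suc k))) * (raise ^^ Suc k) f m" .
  qed
qed

text \<open>Applying \<open>lower\<close> to raise^(j+1) f = 0 and then \<open>raise\<close> once
  more shows that raise^(j+2) kills \<open>lower f\<close>. That function lies one degree lower,
  where the weight is larger by 2, so it is 0 by induction on the degree. The commutator then leaves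
  a multiple of raise^j f, nonzero since j < \<open>weight i\<close>, and j decreases.\<close>

lemma raise_power_injective:
  assumes "homogeneous i f" "(raise ^^ j) f = (\<lambda>_. 0)" "int j \<le> weight i"
  shows "f = (\<lambda>_. 0)"
  using assms
proof (induction i arbitrary: f j rule: less_induct)
  case (less i)
  show ?case using less.prems
  proof (induction j)
    case (Suc j)
    have lower0: "lower f = (\<lambda>_. 0)"
    proof (cases i)
      case 0
      then show ?thesis using lower_nonzero(2)[OF less.prems(1)] by fastforce
    next
      case (Suc i')
      have "homogeneous i' (lower f)"
        using lower_nonzero[OF less.prems(1)] Suc by (auto simp: homogeneous_def)
      moreover have "(raise ^^ Suc (Suc j)) (lower f) = (\<lambda>_. 0)"
      proof -
        have "lower ((raise ^^ Suc j) f) = (\<lambda>_. 0)"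
          unfolding Suc.prems(2) by simp
        then have *: "(raise ^^ Suc j) (lower f)
            = (\<lambda>m. 0 + of_int (- ((int j + 1) * (weight i - int j))) * (raise ^^ j) f m)"
          unfolding lower_raise_power[OF less.prems(1)]
          by (auto simp: fun_eq_iff add_eq_0_iff2)
        have "(raise ^^ Suc (Suc j)) (lower f) = raise ((raise ^^ Suc j) (lower f))"
          by simp
        also have "\<dots> = (\<lambda>m. 0 + of_int (- ((int j + 1) * (weight i - int j))) * (raise ^^ Suc j) f m)"
          unfolding * raise_linear by (simp add: fun_eq_iff raise_linear)
        also have "\<dots> = (\<lambda>_. 0)" unfolding Suc.prems(2) by simp
        finally show ?thesis .
      qed
      moreover have "int (Suc (Suc j)) \<le> weight i'"
        using Suc.prems(3) \<open>i = Suc i'\<close> by (simp add: weight_def)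
      ultimately show ?thesis using less.IH[of i'] Suc by blast
    qed
    have "(raise ^^ j) f m = 0" for m
    proof -
      have "of_int ((int j + 1) * (weight i - int j)) * (raise ^^ j) f m = 0"
        using fun_cong[OF lower_raise_power[OF less.prems(1), of j], of m]
        unfolding lower0 Suc.prems(2) by simp
      moreover have "(int j + 1) * (weight i - int j) \<noteq> 0" using Suc.prems(3) by simp
      ultimately show ?thesis by (simp del: of_int_mult)
    qed
    then show ?case using Suc.IH[OF less.prems(1)] Suc.prems(3) by (simp add: fun_eq_iff)
  qed simp
qed

end

section \<open>From coefficient functions back to polynomials\<close>

definition varsum :: "nat \<Rightarrow> 'k::field mpoly" where
  "varsum n = (\<Sum>i\<in>{1..n}. var i)"

lemma lookup_var_times:
  fixes p :: "'k::field mpoly"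
  shows "lookup (var i * p) m = (if lookup m i > 0 then lookup p (m - unit_exp i) else 0)"
proof (cases "lookup m i > 0")
  case True
  then have "m = unit_exp i + (m - unit_exp i)" using exp_shift(2)[of m i] by (simp add: add.commute)
  then show ?thesis
    using lookup_single_times[of "unit_exp i" 1 p "m - unit_exp i"] True by (simp add: var_def)
next
  case False
  then have "m \<noteq> unit_exp i + b" for b by (auto simp: lookup_add)
  then show ?thesis using False lookup_single_times_eq_0[of m "unit_exp i"] by (simp add: var_def)
qed

lemma lookup_varsum_times:
  fixes p :: "'k::field mpoly"
  shows "lookup (varsum n * p) m
    = (\<Sum>i\<in>{1..n}. if lookup m i > 0 then lookup p (m - unit_exp i) else 0)"
  by (simp add: varsum_def sum_distrib_right lookup_sum lookup_var_times)

text \<open>The second assumption says that the product vanishes modulo the monomial ideal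
  complementary to the box; the bound on j keeps the target at or below the degree symmetric to
  i.\<close>

lemma box_lefschetz:
  fixes p :: "'k::field_char_0 mpoly"
  assumes deg: "\<And>m. m \<in> keys p \<Longrightarrow> monom_degree m = i"
    and 0: "\<And>m. m \<in> box n e \<Longrightarrow> lookup (varsum n ^ j * p) m = 0"
    and le: "int j + 2 * int i \<le> (\<Sum>k\<in>{1..n}. int (e k) - 1)"
    and m: "m \<in> box n e"
  shows "lookup p m = 0"
proof -
  interpret monomial_box n e "TYPE('k)" .
  define trunc where "trunc q m = (if m \<in> box n e then lookup q m else 0)" for q :: "'k mpoly" and m
  \<comment> \<open>Truncation commutes with multiplication because the box is closed under
    divisors.\<close>
  have 1: "trunc (varsum n * q) = raise (trunc q)" for q
    by (auto simp: trunc_def raise_def up_def lookup_varsum_times box_minus fun_eq_iff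
        intro!: sum.cong)
  have "trunc (varsum n ^ k * p) = (raise ^^ k) (trunc p)" for k
    by (induction k) (simp_all add: 1 mult.assoc)
  moreover have "trunc (varsum n ^ j * p) = (\<lambda>_. 0)"
    using 0 by (auto simp: trunc_def fun_eq_iff)
  ultimately have "(raise ^^ j) (trunc p) = (\<lambda>_. 0)" by metis
  with _ have "trunc p = (\<lambda>_. 0)"
  proof (rule raise_power_injective)
    show "homogeneous i (trunc p)"
      using deg by (auto simp: homogeneous_def trunc_def in_keys_iff)
    show "int j \<le> weight i" unfolding weight_def using le by linarith
  qed
  then have "trunc p m = 0" by simp
  then show ?thesis using m by (simp add: trunc_def)
qed

section \<open>Generic nonsingularity\<close>

text \<open>Injectivity at 0 makes the determinant a nonzero polynomial, and B is its finite set of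
  roots. Solvability and injectivity are exported for the same B, as both are needed for one
  matrix.\<close>

lemma generic_nonsingular:
  fixes M :: "'a \<Rightarrow> 'a \<Rightarrow> 'k::field poly"
  assumes T: "finite T"
    and inj: "\<And>x. (\<And>v. v \<in> T \<Longrightarrow> (\<Sum>u\<in>T. poly (M v u) 0 * x u) = 0) \<Longrightarrow> \<forall>u\<in>T. x u = 0"
  obtains B where "finite B"
    and "\<And>c y. c \<notin> B \<Longrightarrow> \<exists>x. \<forall>v\<in>T. (\<Sum>u\<in>T. poly (M v u) c * x u) = y v"
    and "\<And>c x. c \<notin> B \<Longrightarrow> (\<And>v. v \<in> T \<Longrightarrow> (\<Sum>u\<in>T. poly (M v u) c * x u) = 0) \<Longrightarrow> \<forall>u\<in>T. x u = 0"
proof -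
  define N where "N = card T"
  obtain h where h: "bij_betw h {0..<N} T"
    using ex_bij_betw_nat_finite[OF T] N_def by blast
  define g where "g = inv_into {0..<N} h"
  have g: "u \<in> T \<Longrightarrow> g u < N" "u \<in> T \<Longrightarrow> h (g u) = u" for u
    using h unfolding g_def
    by (metis atLeastLessThan_iff bij_betw_imp_surj_on inv_into_into, metis bij_betw_inv_into_right)
  have gh: "b < N \<Longrightarrow> g (h b) = b" "b < N \<Longrightarrow> h b \<in> T" for b
    using h unfolding g_def
    by (simp add: bij_betw_inv_into_left, auto dest: bij_betwE)
  define A where "A = mat N N (\<lambda>(a, b). M (h a) (h b))"
  define E where "E c = map_mat (\<lambda>p. poly p c) A" for c
  have A: "A \<in> carrier_mat N N" by (simp add: A_def)
  have E: "E c \<in> carrier_mat N N" for c by (simp add: E_def A_def)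
  have detE: "det (E c) = poly (det A) c" for c
  proof -
    interpret comm_ring_hom "\<lambda>p. poly p c" by unfold_locales simp_all
    show ?thesis unfolding E_def by (rule hom_det)
  qed
  have apply_E: "(E c *\<^sub>v vec N x) $ a = (\<Sum>u\<in>T. poly (M (h a) u) c * x (g u))"
    if "a < N" for c x a
  proof -
    have "(E c *\<^sub>v vec N x) $ a = (\<Sum>b\<in>{0..<N}. poly (M (h a) (h b)) c * x b)"
      using that by (simp add: E_def A_def scalar_prod_def)
    also have "\<dots> = (\<Sum>b\<in>{0..<N}. poly (M (h a) (h b)) c * x (g (h b)))"
      by (intro sum.cong) (simp_all add: gh)
    also have "\<dots> = (\<Sum>u\<in>T. poly (M (h a) u) c * x (g u))"
      by (rule sum.reindex_bij_betw[OF h])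
    finally show ?thesis .
  qed
  have kernel: "\<forall>u\<in>T. x u = 0"
    if "det (E c) \<noteq> 0" "\<And>v. v \<in> T \<Longrightarrow> (\<Sum>u\<in>T. poly (M v u) c * x u) = 0" for c x
  proof -
    let ?x = "vec N (\<lambda>b. x (h b))"
    have "E c *\<^sub>v ?x = 0\<^sub>v N"
    proof (rule eq_vecI)
      fix a assume "a < dim_vec (0\<^sub>v N :: 'k vec)"
      then have "a < N" by simp
      then have "(E c *\<^sub>v ?x) $ a = (\<Sum>u\<in>T. poly (M (h a) u) c * x u)"
        unfolding apply_E[OF \<open>a < N\<close>] by (intro sum.cong) (simp_all add: g)
      then show "(E c *\<^sub>v ?x) $ a = 0\<^sub>v N $ a" using that(2) gh(2) \<open>a < N\<close> by simp
    qed (simp add: E_def A_def)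
    then have "?x = 0\<^sub>v N"
      using that(1) det_0_iff_vec_prod_zero_field[OF E[of c]] by (metis vec_carrier)
    then have "?x $ g u = 0" if "u \<in> T" for u using g that by simp
    then show ?thesis using g by simp
  qed
  have det0: "det (E 0) \<noteq> 0"
  proof
    assume "det (E 0) = 0"
    then obtain v where v: "v \<in> carrier_vec N" "v \<noteq> 0\<^sub>v N" "E 0 *\<^sub>v v = 0\<^sub>v N"
      using det_0_iff_vec_prod_zero_field[OF E[of 0]] by auto
    have vv: "v = vec N (\<lambda>b. v $ b)" using v(1) by auto
    have "\<forall>u\<in>T. v $ g u = 0"
    proof (rule inj)
      fix w assume w: "w \<in> T"
      have "(E 0 *\<^sub>v vec N (\<lambda>b. v $ b)) $ g w = 0"
        using v(3) g w by (simp flip: vv)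
      then show "(\<Sum>u\<in>T. poly (M w u) 0 * v $ g u) = 0"
        using apply_E[of "g w" 0 "\<lambda>b. v $ b"] g w by simp
    qed
    then have "v $ b = 0" if "b < N" for b using gh that by metis
    then have "v = 0\<^sub>v N" using v(1) by auto
    with v(2) show False by simp
  qed
  show ?thesis
  proof (rule that)
    have "det A \<noteq> 0" using det0 detE[of 0] by auto
    then show "finite {c. poly (det A) c = 0}" by (rule poly_roots_finite)
  next
    fix c y assume "c \<notin> {c. poly (det A) c = 0}"
    then have "det (E c) \<noteq> 0" by (simp add: detE)
    from det_non_zero_imp_unit[OF E this, of "()"]
    obtain B where B: "B \<in> carrier_mat N N" "E c * B = 1\<^sub>m N"
      by (auto simp: Units_def ring_mat_def)
    define z where "z = B *\<^sub>v vec N (\<lambda>b. y (h b))"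
    have z: "z \<in> carrier_vec N" using B by (simp add: z_def)
    have vz: "z = vec N (\<lambda>b. z $ b)" using z by auto
    have "E c *\<^sub>v z = vec N (\<lambda>b. y (h b))"
      unfolding z_def using B E[of c] by (simp flip: assoc_mult_mat_vec)
    then have "(E c *\<^sub>v vec N (\<lambda>b. z $ b)) $ g v = y v" if "v \<in> T" for v
      using g that by (simp flip: vz)
    then have "\<forall>v\<in>T. (\<Sum>u\<in>T. poly (M v u) c * z $ g u) = y v"
      using apply_E[of "g v" c "\<lambda>b. z $ b" for v] g by simp
    then show "\<exists>x. \<forall>v\<in>T. (\<Sum>u\<in>T. poly (M v u) c * x u) = y v"
      by (rule exI[of _ "\<lambda>u. z $ g u"])
  next
    fix c x assume "c \<notin> {c. poly (det A) c = 0}"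
      "\<And>v. v \<in> T \<Longrightarrow> (\<Sum>u\<in>T. poly (M v u) c * x u) = 0"
    then show "\<forall>u\<in>T. x u = 0" by (intro kernel[of c]) (simp_all add: detE)
  qed
qed

section \<open>The dual description of the ideal\<close>

lemma K'_generator:
  "var 1 ^ k + const c * (\<Prod>i\<in>{2..n}. var i ^ \<alpha> i)
    = (single (single 1 k) 1 + single (\<Sum>i\<in>{2..n}. single i (\<alpha> i)) c :: 'k::field mpoly)"
  by (subst prod_var_pow) (simp_all add: var_pow const_def mult_single)

lemma var_pow_mult:
  "var i ^ k * var j ^ l = (single (single i k + single j l) 1 :: 'k::field mpoly)"
  by (simp add: var_pow mult_single)

text \<open>\<open>proper\<close> says that no mixed generator x_1^(d_1 - \<alpha>_1) x_i^(d_i -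
  \<alpha>_i) equals 1; for i \<ge> 2 positivity of \<open>d i\<close> says the same of the pure
  powers.\<close>

locale exponents =
  fixes n :: nat and d \<alpha> :: "nat \<Rightarrow> nat"
  assumes n: "n \<ge> 1"
    and \<alpha>_le: "i \<in> {1..n} \<Longrightarrow> \<alpha> i \<le> d i"
    and d_pos: "i \<in> {1..n} \<Longrightarrow> 0 < d i"
    and proper: "\<alpha> 1 < d 1 \<or> (\<forall>i\<in>{2..n}. \<alpha> i < d i)"
begin

text \<open>\<open>top_at q m\<close> holds iff replacing the \<open>d 1\<close>-th power of the first variable \<open>q - 1\<close> times turns
  \<open>m\<close> into the monomial with exponents \<open>d 1 - \<alpha> 1 - 1\<close> and \<open>d i - 1\<close>. The equations are free of
  truncated subtraction and remain meaningful for \<open>\<alpha> 1 = d 1\<close>, when \<open>q = 1\<close> cannot occur.\<close>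

definition top_at :: "nat \<Rightarrow> (nat \<Rightarrow>\<^sub>0 nat) \<Rightarrow> bool" where
  "top_at q m \<longleftrightarrow> lookup m 1 + \<alpha> 1 + 1 = q * d 1 \<and>
     (\<forall>i\<in>{2..n}. Suc (lookup m i + q * \<alpha> i) = d i + \<alpha> i)"

text \<open>Phi on monomials, with z = -c. The level is recovered from the x_1-exponent by division,
  which avoids a choice of q.\<close>

definition top_weight :: "'k::field \<Rightarrow> (nat \<Rightarrow>\<^sub>0 nat) \<Rightarrow> 'k" where
  "top_weight z m = (let q = (lookup m 1 + \<alpha> 1 + 1) div d 1 in
     if top_at q m then z ^ (q - 1) else 0)"

text \<open>The standard monomials for the leading terms x_1^(d_1), x_i^(d_i) and x_1^(d_1 -
  \<alpha>_1) x_i^(d_i - \<alpha>_i).\<close>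

definition normal :: "(nat \<Rightarrow>\<^sub>0 nat) set" where
  "normal = {m \<in> monoms n. (\<forall>i\<in>{1..n}. lookup m i < d i) \<and>
     (lookup m 1 + \<alpha> 1 < d 1 \<or> (\<forall>i\<in>{2..n}. lookup m i + \<alpha> i < d i))}"

text \<open>The product \<open>compl m + m\<close> lies at level 1 of the top monomials, or at level 2 if \<open>m\<close> is late.\<close>

definition late :: "(nat \<Rightarrow>\<^sub>0 nat) \<Rightarrow> bool" where
  "late m \<longleftrightarrow> d 1 \<le> lookup m 1 + \<alpha> 1"

definition compl :: "(nat \<Rightarrow>\<^sub>0 nat) \<Rightarrow> nat \<Rightarrow>\<^sub>0 nat" where
  "compl m = (\<Sum>i\<in>{1..n}. single i
     (if i = 1 then (if late m then 2 * d 1 else d 1) - \<alpha> 1 - 1 - lookup m 1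
      else (if late m then d i - \<alpha> i else d i) - 1 - lookup m i))"

text \<open>The socle degree. Subtraction comes last, because for \<alpha>_1 = d_1 the exponent d_1
  - \<alpha>_1 - 1 on its own would truncate.\<close>

definition top_degree :: nat where
  "top_degree = d 1 + (\<Sum>i\<in>{2..n}. d i - 1) - \<alpha> 1 - 1"

lemma d1_pos: "0 < d 1" and \<alpha>1_le: "\<alpha> 1 \<le> d 1"
  using n d_pos[of 1] \<alpha>_le[of 1] by auto

lemma insert_1: "{1..n} = insert 1 {2..n}"
  using n by auto

lemma top_atD:
  assumes "top_at q m"
  shows "lookup m 1 + \<alpha> 1 + 1 = q * d 1"
    and "i \<in> {2..n} \<Longrightarrow> Suc (lookup m i + q * \<alpha> i) = d i + \<alpha> i"
  using assms by (auto simp: top_at_def)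

lemma top_at_pos: "top_at q m \<Longrightarrow> 0 < q"
  by (cases q) (auto simp: top_at_def)

lemma top_weight_top:
  assumes "top_at q m"
  shows "top_weight z m = z ^ (q - 1)"
proof -
  have "(lookup m 1 + \<alpha> 1 + 1) div d 1 = q"
    using assms d1_pos by (simp add: top_at_def)
  with assms show ?thesis by (simp add: top_weight_def Let_def)
qed

lemma top_weight_eq_0: "(\<And>q. \<not> top_at q m) \<Longrightarrow> top_weight z m = 0"
  by (simp add: top_weight_def Let_def)

lemma normal_monoms: "m \<in> normal \<Longrightarrow> m \<in> monoms n"
  by (simp add: normal_def)

lemma normal_less: "m \<in> normal \<Longrightarrow> i \<in> {1..n} \<Longrightarrow> lookup m i < d i"
  by (simp add: normal_def)

lemma late_less: "m \<in> normal \<Longrightarrow> late m \<Longrightarrow> i \<in> {2..n} \<Longrightarrow> lookup m i + \<alpha> i < d i"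
  by (auto simp: normal_def late_def)

lemma zero_normal: "0 \<in> normal"
  using d_pos proper by (auto simp: normal_def)

lemma finite_normal: "finite normal"
proof -
  \<comment> \<open>A common bound for all coordinates, since
    \<open>finite_set_of_finite_funs\<close> takes a single range.\<close>
  have "finite {f. \<forall>i. (i \<in> {1..n} \<longrightarrow> f i \<in> {..\<Sum>i\<in>{1..n}. d i}) \<and> (i \<notin> {1..n} \<longrightarrow> f i = (0::nat))}"
    by (rule finite_set_of_finite_funs) simp_all
  moreover have "lookup ` normal
      \<subseteq> {f. \<forall>i. (i \<in> {1..n} \<longrightarrow> f i \<in> {..\<Sum>i\<in>{1..n}. d i}) \<and> (i \<notin> {1..n} \<longrightarrow> f i = (0::nat))}"
  proof safe
    fix m i assume m: "m \<in> normal" "i \<in> {1..n}"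
    have "lookup m i \<le> d i" using normal_less[OF m] by simp
    also have "d i \<le> (\<Sum>i\<in>{1..n}. d i)" using m by (intro member_le_sum) auto
    finally show "lookup m i \<le> (\<Sum>i\<in>{1..n}. d i)" .
  next
    fix m i assume "m \<in> normal" "i \<notin> {1..n}"
    then show "lookup m i = 0" using normal_monoms lookup_monoms by blast
  qed
  ultimately have "finite (lookup ` normal)" by (rule finite_subset[rotated])
  moreover have "inj_on lookup normal" by (rule inj_onI) (rule poly_mapping_eqI, simp)
  ultimately show ?thesis by (rule finite_imageD)
qed

section \<open>The complement involution and the pairing on normal monomials\<close>

lemma compl_monoms: "compl m \<in> monoms n"
  unfolding compl_def by (intro monoms_sum monoms_single)

lemma lookup_compl:
  "i \<in> {1..n} \<Longrightarrow> lookup (compl m) i =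
    (if i = 1 then (if late m then 2 * d 1 else d 1) - \<alpha> 1 - 1 - lookup m 1
     else (if late m then d i - \<alpha> i else d i) - 1 - lookup m i)"
  unfolding compl_def lookup_sum by (simp add: lookup_single when_def)

lemma lookup_compl_1:
  "lookup (compl m) (Suc 0) = (if late m then 2 * d 1 else d 1) - \<alpha> 1 - 1 - lookup m 1"
  using n by (simp add: lookup_compl)

lemma lookup_compl_2:
  "i \<in> {2..n} \<Longrightarrow> lookup (compl m) i = (if late m then d i - \<alpha> i else d i) - 1 - lookup m i"
  by (simp add: lookup_compl)

lemma compl_sum_1:
  assumes "m \<in> normal"
  shows "lookup (compl m) 1 + lookup m 1 + \<alpha> 1 + 1 = (if late m then 2 * d 1 else d 1)"
  using normal_less[OF assms, of 1] n \<alpha>1_le by (auto simp: lookup_compl_1 late_def)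

lemma compl_sum_2:
  assumes "m \<in> normal" "i \<in> {2..n}"
  shows "lookup (compl m) i + lookup m i + 1 = (if late m then d i - \<alpha> i else d i)"
  using normal_less[OF assms(1), of i] late_less[OF assms(1) _ assms(2)] assms(2)
  by (auto simp: lookup_compl_2)

lemma late_compl:
  assumes "m \<in> normal"
  shows "late (compl m) \<longleftrightarrow> late m"
  using compl_sum_1[OF assms] normal_less[OF assms, of 1] n
  by (auto simp: late_def split: if_splits)

lemma compl_normal:
  assumes m: "m \<in> normal"
  shows "compl m \<in> normal"
proof -
  have "lookup (compl m) 1 < d 1"
    using compl_sum_1[OF m] by (auto simp: late_def split: if_splits)
  moreover have "lookup (compl m) i < d i" if "i \<in> {2..n}" for i
    using compl_sum_2[OF m that] by (auto split: if_splits)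
  moreover have "lookup (compl m) 1 + \<alpha> 1 < d 1 \<or> (\<forall>i\<in>{2..n}. lookup (compl m) i + \<alpha> i < d i)"
  proof (cases "late m")
    case True
    then have "lookup (compl m) i + \<alpha> i < d i" if "i \<in> {2..n}" for i
      using compl_sum_2[OF m that] by auto
    then show ?thesis by blast
  next
    case False
    then show ?thesis using late_compl[OF m] by (simp add: late_def)
  qed
  ultimately show ?thesis
    unfolding normal_def insert_1 using compl_monoms by blast
qed

lemma top_at_compl:
  assumes m: "m \<in> normal"
  shows "top_at (if late m then 2 else 1) (compl m + m)"
  unfolding top_at_def
proof (intro conjI ballI)
  show "lookup (compl m + m) 1 + \<alpha> 1 + 1 = (if late m then 2 else 1) * d 1"
    using compl_sum_1[OF m] by (auto simp: lookup_add)
  fix i assume i: "i \<in> {2..n}"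
  then show "Suc (lookup (compl m + m) i + (if late m then 2 else 1) * \<alpha> i) = d i + \<alpha> i"
    using compl_sum_2[OF m i] late_less[OF m _ i] \<alpha>_le[of i]
    by (auto simp: lookup_add split: if_splits)
qed

lemma top_at_unique:
  assumes "a \<in> monoms n" "b \<in> monoms n" "top_at q (a + m)" "top_at q (b + m)"
  shows "a = b"
proof (rule monoms_eqI[OF assms(1,2)])
  fix i assume i: "i \<in> {1..n}"
  show "lookup a i = lookup b i"
  proof (cases "i = 1")
    case True
    then show ?thesis using assms(3,4) by (simp add: top_at_def lookup_add)
  next
    case False
    with i have "i \<in> {2..n}" by auto
    then have "Suc (lookup (a + m) i + q * \<alpha> i) = Suc (lookup (b + m) i + q * \<alpha> i)"
      using assms(3,4) unfolding top_at_def by metis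
    then show ?thesis by (simp add: lookup_add)
  qed
qed

lemma compl_unique:
  assumes "m \<in> normal" "a \<in> monoms n" "top_at (if late m then 2 else 1) (a + m)"
  shows "a = compl m"
  using top_at_unique[OF assms(2) compl_monoms assms(3) top_at_compl[OF assms(1)]] .

lemma compl_compl:
  assumes "m \<in> normal"
  shows "compl (compl m) = m"
  using top_at_compl[OF assms]
  by (intro compl_unique[symmetric] compl_normal[OF assms] normal_monoms[OF assms])
    (simp only: late_compl[OF assms] add.commute)

text \<open>At level 1 the x_1-exponent is d_1 - \<alpha>_1 - 1, which a late factor already
  exceeds. This makes the late rows divisible by z.\<close>

lemma late_level:
  assumes "top_at q (a + m)" "late m"
  shows "2 \<le> q"
proof (rule ccontr)
  assume "\<not> 2 \<le> q"
  then have "q * d 1 \<le> 1 * d 1" by (intro mult_le_mono1) simp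
  moreover have "lookup a 1 + lookup m 1 + \<alpha> 1 + 1 = q * d 1"
    using assms by (simp add: top_at_def lookup_add)
  ultimately show False using assms(2) unfolding late_def by linarith
qed

lemma top_at_compl_imp_eq:
  assumes m: "m \<in> normal" and s: "s \<in> normal" and top: "top_at q (compl m + s)"
  shows "s = m"
proof -
  let ?l = "if late m then 2 else 1 :: nat"
  have lt: "lookup s 1 < d 1" "lookup m 1 < d 1"
    using n normal_less[OF s] normal_less[OF m] by auto
  have "lookup (compl m) 1 + lookup s 1 + \<alpha> 1 + 1 = q * d 1"
    using top by (simp add: top_at_def lookup_add)
  moreover have "lookup (compl m) 1 + lookup m 1 + \<alpha> 1 + 1 = ?l * d 1"
    using compl_sum_1[OF m] by auto
  \<comment> \<open>The x_1-exponents of s and m differ by less than \<open>d 1\<close>, so the two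
    levels agree.\<close>
  ultimately have "q * d 1 < Suc ?l * d 1" "?l * d 1 < Suc q * d 1"
    using lt by (simp_all only: mult_Suc)
  then have "q < Suc ?l" "?l < Suc q" by (auto simp only: mult_less_cancel2)
  then have q: "q = ?l" by linarith
  show ?thesis
  proof (rule top_at_unique)
    show "top_at q (s + compl m)" using top by (simp add: add.commute)
    show "top_at q (m + compl m)" using top_at_compl[OF m] by (simp only: q add.commute)
  qed (use m s normal_monoms in auto)
qed

text \<open>The pairing of complements with normal monomials is diagonal, with entries 1 and z; a
  coefficient of a normal remainder can thus be read off by Phi.\<close>

lemma top_weight_compl:
  assumes "m \<in> normal" "s \<in> normal"
  shows "top_weight z (compl m + s) = (if s = m then z ^ (if late m then 1 else 0) else 0)"
proof (cases "s = m")
  case True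
  then show ?thesis using top_weight_top[OF top_at_compl[OF assms(1)], of z] by simp
next
  case False
  then show ?thesis using top_at_compl_imp_eq[OF assms] top_weight_eq_0 by auto
qed

text \<open>Each further level trades the exponents \<alpha>_i for d_1 more factors x_1, so the
  degree is constant when d_1 is the sum of the \<alpha>_i.\<close>

lemma top_at_degree:
  assumes m: "m \<in> monoms n" and top: "top_at q m" and q: "q = 1 \<or> d 1 = (\<Sum>i\<in>{2..n}. \<alpha> i)"
  shows "monom_degree m = top_degree"
proof -
  have d2: "0 < d i" if "i \<in> {2..n}" for i using that d_pos[of i] by simp
  have "monom_degree m = lookup m 1 + (\<Sum>i\<in>{2..n}. lookup m i)"
    unfolding monom_degree_monoms[OF m] insert_1 by simp
  moreover have "lookup m 1 + \<alpha> 1 + 1 = q * d 1"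
    using top by (simp add: top_at_def)
  moreover have "(\<Sum>i\<in>{2..n}. lookup m i) + q * (\<Sum>i\<in>{2..n}. \<alpha> i)
      = (\<Sum>i\<in>{2..n}. d i - 1) + (\<Sum>i\<in>{2..n}. \<alpha> i)"
    unfolding sum_distrib_left sum.distrib[symmetric]
  proof (rule sum.cong)
    fix i assume i: "i \<in> {2..n}"
    then have "Suc (lookup m i + q * \<alpha> i) = d i + \<alpha> i" using top by (auto simp: top_at_def)
    then show "lookup m i + q * \<alpha> i = d i - 1 + \<alpha> i" using d2[OF i] by simp
  qed simp
  ultimately show ?thesis
    using q by (auto simp: top_degree_def)
qed

text \<open>The largest ideal inside the kernel of Phi; by linearity monomials suffice as
  multipliers.\<close>

definition dual :: "'k::field \<Rightarrow> 'k mpoly set" where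
  "dual z = {p \<in> carrier (poly_ring n). \<forall>m\<in>monoms n. lin (\<lambda>k. top_weight z (m + k)) p = 0}"

lemma dual_ideal: "ideal (dual z) (poly_ring n)"
  by (rule ideal_poly_ringI)
    (auto simp: dual_def lin_add lin_single_times add.assoc[symmetric])

lemma K'_subset_dual: "K' n d \<alpha> (- z) \<subseteq> dual z"
proof (rule K'_least[OF n dual_ideal])
  define a where "a = single (1 :: nat) (d 1)"
  define b where "b = (\<Sum>i\<in>{2..n}. single i (\<alpha> i))"
  have ab: "a \<in> monoms n" "b \<in> monoms n"
    using n by (auto simp: a_def b_def intro!: monoms_sum)
  have b1: "lookup b (Suc 0) = 0" by (simp add: b_def lookup_sum lookup_single when_def)
  have b2: "lookup b i = \<alpha> i" if "i \<in> {2..n}" for i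
    using that by (simp add: b_def lookup_sum lookup_single when_def)
  have a: "lookup a i = (if i = 1 then d 1 else 0)" for i
    by (simp add: a_def lookup_single when_def)
  \<comment> \<open>Multiplying by x_1^(d_1) instead of the monomial with exponents \<alpha>_i
    raises the level by one, hence the weight by a factor z.\<close>
  have shift: "top_at (Suc q) (m + a) \<longleftrightarrow> top_at q (m + b)" for q m
    by (auto simp: top_at_def lookup_add a b1 b2 algebra_simps)
  have "top_weight z (m + a) = z * top_weight z (m + b)" for m
  proof (cases "\<exists>q. top_at q (m + b)")
    case True
    then obtain q where q: "top_at q (m + b)" by blast
    then have "top_weight z (m + a) = z ^ q" using shift top_weight_top by fastforce
    then show ?thesis using top_weight_top[OF q, of z] top_at_pos[OF q] by (simp flip: power_Suc)
  next
    case False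
    then have "\<not> top_at q (m + a)" for q using shift top_at_pos[of q "m + a"] by (cases q) auto
    moreover have "\<not> top_at q (m + b)" for q using False by blast
    ultimately show ?thesis by (simp add: top_weight_eq_0)
  qed
  then have "single a 1 + single b (- z) \<in> dual z"
    using ab by (simp add: dual_def lin_add)
  then show "var 1 ^ d 1 + const (- z) * (\<Prod>i\<in>{2..n}. var i ^ \<alpha> i) \<in> dual z"
    unfolding K'_generator a_def b_def .
next
  fix i assume i: "i \<in> {2..n}"
  have "\<not> top_at q (m + single i (d i))" for q m
  proof
    assume top: "top_at q (m + single i (d i))"
    then have "Suc (lookup m i + d i + q * \<alpha> i) = d i + \<alpha> i"
      using top_atD(2)[OF top i] by (simp add: lookup_add)
    moreover have "1 * \<alpha> i \<le> q * \<alpha> i" using top_at_pos[OF top] by (intro mult_le_mono1) simp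
    ultimately show False by simp
  qed
  then show "var i ^ d i \<in> dual z"
    using i by (simp add: var_pow dual_def top_weight_eq_0)
next
  fix i assume i: "i \<in> {2..n}"
  define a where "a = single 1 (d 1 - \<alpha> 1) + single i (d i - \<alpha> i)"
  have a: "a \<in> monoms n" "lookup a (Suc 0) = d 1 - \<alpha> 1" "lookup a i = d i - \<alpha> i"
    using i n by (auto simp: a_def lookup_add lookup_single when_def)
  have "\<not> top_at q (m + a)" for q m
  proof
    assume top: "top_at q (m + a)"
    then have 1: "Suc (lookup m i + (d i - \<alpha> i) + q * \<alpha> i) = d i + \<alpha> i"
      using top_atD(2)[OF top i] by (simp add: lookup_add a)
    have "lookup m 1 + d 1 + 1 = q * d 1"
      using top_atD(1)[OF top] \<alpha>1_le by (simp add: lookup_add a)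
    then have "1 * d 1 < q * d 1" by linarith
    \<comment> \<open>The x_1-exponent excludes level 1, and from level 2 on x_i has exponent below
      d_i - \<alpha>_i.\<close>
    then have "2 \<le> q" unfolding mult_less_cancel2 by linarith
    then have "2 * \<alpha> i \<le> q * \<alpha> i" by (intro mult_le_mono1)
    moreover have "\<alpha> i \<le> d i" using \<alpha>_le i by simp
    ultimately show False using 1 by linarith
  qed
  then have "single a 1 \<in> dual z"
    using a(1) by (simp add: dual_def top_weight_eq_0)
  then show "var 1 ^ (d 1 - \<alpha> 1) * var i ^ (d i - \<alpha> i) \<in> dual z"
    unfolding var_pow_mult a_def .
qed

end

locale exponents_coeff = exponents n d \<alpha> for n d \<alpha> +
  fixes c :: "'k::field"
  assumes nondeg: "c \<noteq> 0 \<or> \<alpha> 1 = 0"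
    and homog: "c = 0 \<or> d 1 = (\<Sum>i\<in>{2..n}. \<alpha> i)"
begin

abbreviation K :: "'k mpoly set" where "K \<equiv> K' n d \<alpha> c"

abbreviation wt :: "(nat \<Rightarrow>\<^sub>0 nat) \<Rightarrow> 'k" where "wt \<equiv> top_weight (- c)"

lemma K_ideal: "ideal K (poly_ring n)"
  by (rule K'_ideal[OF n])

lemma K_multiple:
  assumes "single a b \<in> K" "m \<in> monoms n" "m = a + k"
  shows "single m b \<in> K"
proof -
  have "single k 1 * single a b \<in> K"
    using assms by (intro poly_ideal_mult[OF K_ideal]) auto
  then show ?thesis using assms by (simp add: mult_single add.commute)
qed

text \<open>Replacing x_1^(d_1) lowers the x_1-exponent, on which the induction runs; multiples of
  the other generators reduce to 0. The degree is recorded so that reduction respects the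
  grading.\<close>

lemma reduce_monom:
  assumes "m \<in> monoms n"
  shows "\<exists>r. keys r \<subseteq> {s \<in> normal. monom_degree s = monom_degree m} \<and> single m 1 - r \<in> K"
  using assms
proof (induction "lookup m 1" arbitrary: m rule: less_induct)
  case less
  have K_0: ?case if "single m 1 \<in> K"
    using that by (intro exI[of _ 0]) simp
  consider (pow) i where "i \<in> {2..n}" "d i \<le> lookup m i"
    | (first) "d 1 \<le> lookup m 1"
    | (mixed) i where "i \<in> {2..n}" "d i \<le> lookup m i + \<alpha> i" "d 1 \<le> lookup m 1 + \<alpha> 1"
    | (normal) "m \<in> normal"
    using less.prems unfolding normal_def insert_1 by fastforce
  then show ?case
  proof cases
    case pow
    have m: "m = single i (d i) + (m - single i (d i))"
      using pow less.prems by (intro monoms_le[of _ n]) (auto simp: lookup_single when_def)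
    have "single (single i (d i)) 1 \<in> K"
      using K'_pow[OF n pow(1), of d \<alpha> c] by (simp add: var_pow)
    from K_0[OF K_multiple[OF this less.prems m]] show ?thesis .
  next
    case mixed
    define a where "a = single 1 (d 1 - \<alpha> 1) + single i (d i - \<alpha> i)"
    have "a \<in> monoms n" using mixed n by (simp add: a_def)
    then have m: "m = a + (m - a)"
      using mixed less.prems
      by (intro monoms_le[of _ n]) (auto simp: a_def lookup_add lookup_single when_def)
    have "single a 1 \<in> K"
      using K'_right[OF n mixed(1), of d \<alpha> c] unfolding var_pow_mult a_def .
    from K_0[OF K_multiple[OF this less.prems m]] show ?thesis .
  next
    case first
    define a where "a = single (1 :: nat) (d 1)"
    define b where "b = (\<Sum>i\<in>{2..n}. single i (\<alpha> i))"
    have ab: "a \<in> monoms n" "b \<in> monoms n"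
      using n by (auto simp: a_def b_def intro!: monoms_sum)
    have b1: "lookup b (Suc 0) = 0" by (simp add: b_def lookup_sum lookup_single when_def)
    have m: "m = a + (m - a)"
      using first less.prems ab
      by (intro monoms_le[of _ n]) (auto simp: a_def lookup_single when_def)
    have 1: "single a 1 + single b c \<in> K"
      unfolding a_def b_def K'_generator[symmetric] by (rule K'_left[OF n]) blast
    have "single (m - a) 1 * (single a 1 + single b c) \<in> K"
      using less.prems by (intro poly_ideal_mult[OF K_ideal 1]) simp
    then have red: "single m 1 + single (m - a + b) c \<in> K"
      by (subst m) (simp add: distrib_left mult_single add.commute)
    show ?thesis
    proof (cases "c = 0")
      case True
      with red show ?thesis by (intro K_0) simp
    next
      case False
      have "lookup (m - a + b) 1 < lookup m 1"
        using first d1_pos by (simp add: lookup_add lookup_minus b1 a_def)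
      moreover have "m - a + b \<in> monoms n" using less.prems ab by simp
      ultimately obtain r where r: "single (m - a + b) 1 - r \<in> K"
        "keys r \<subseteq> {s \<in> normal. monom_degree s = monom_degree (m - a + b)}"
        using less.hyps[of "m - a + b"] by blast
      have "monom_degree b = d 1"
        using homog False by (simp add: b_def monom_degree_sum)
      then have "monom_degree (m - a + b) = monom_degree (m - a + a)"
        unfolding monom_degree_add by (simp add: a_def)
      then have deg: "monom_degree (m - a + b) = monom_degree m" using m by (simp add: add.commute)
      have "(single m 1 + single (m - a + b) c) - single 0 c * (single (m - a + b) 1 - r) \<in> K"
        by (rule poly_ideal_diff[OF K_ideal red poly_ideal_mult[OF K_ideal r(1)]]) simp
      then have "single m 1 - single 0 (- c) * r \<in> K"
        by (simp add: right_diff_distrib mult_single single_uminus)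
      moreover have "keys (single 0 (- c) * r) \<subseteq> keys r"
        using keys_mult[of "single 0 (- c)" r] by (auto split: if_splits)
      ultimately show ?thesis using r(2) deg by (intro exI[of _ "single 0 (- c) * r"]) auto
    qed
  next
    case normal
    then show ?thesis by (intro exI[of _ "single m 1"]) (simp add: poly_ideal_0[OF K_ideal])
  qed
qed

lemma reduce:
  assumes "p \<in> carrier (poly_ring n)"
  obtains r where "keys r \<subseteq> {s \<in> normal. \<exists>m\<in>keys p. monom_degree s = monom_degree m}"
    and "p - r \<in> K"
proof -
  have "\<forall>m\<in>keys p. \<exists>r. keys r \<subseteq> {s \<in> normal. monom_degree s = monom_degree m} \<and> single m 1 - r \<in> K"
    using assms reduce_monom by (auto simp: carrier_poly_ring)
  from bchoice[OF this] obtain r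
    where r: "\<forall>m\<in>keys p. keys (r m) \<subseteq> {s \<in> normal. monom_degree s = monom_degree m}
      \<and> single m 1 - r m \<in> K" ..
  show ?thesis
  proof (rule that)
    let ?r = "\<Sum>m\<in>keys p. single 0 (lookup p m) * r m"
    have "keys ?r \<subseteq> (\<Union>m\<in>keys p. keys (single 0 (lookup p m) * r m))" by (rule keys_sum)
    also have "\<dots> \<subseteq> (\<Union>m\<in>keys p. keys (r m))"
    proof (intro UN_mono order_refl)
      fix m show "keys (single 0 (lookup p m) * r m) \<subseteq> keys (r m)"
        using keys_mult[of "single 0 (lookup p m)" "r m"] by (auto split: if_splits)
    qed
    finally show "keys ?r \<subseteq> {s \<in> normal. \<exists>m\<in>keys p. monom_degree s = monom_degree m}"
      using r by blast
    have "(\<Sum>m\<in>keys p. single 0 (lookup p m) * (single m 1 - r m)) \<in> K"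
      by (rule poly_ideal_sum[OF K_ideal poly_ideal_mult[OF K_ideal]]) (use r in auto)
    also have "(\<Sum>m\<in>keys p. single 0 (lookup p m) * (single m 1 - r m)) = p - ?r"
      by (simp add: right_diff_distrib mult_single sum_subtractf flip: sum_single)
    finally show "p - ?r \<in> K" .
  qed
qed

lemma wt_compl_nonzero: "m \<in> normal \<Longrightarrow> wt (compl m + m) \<noteq> 0"
  using nondeg normal_less[of m 1] n by (auto simp: top_weight_compl late_def)

lemma lin_wt_compl:
  assumes "keys r \<subseteq> normal" "m \<in> normal"
  shows "lin (\<lambda>k. wt (compl m + k)) r = lookup r m * wt (compl m + m)"
proof -
  have "lin (\<lambda>k. wt (compl m + k)) r = lin (\<lambda>k. of_bool (k = m) * wt (compl m + m)) r"
    using assms by (intro lin_cong) (auto simp: top_weight_compl)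
  also have "\<dots> = lookup r m * wt (compl m + m)"
    unfolding lookup_eq_lin[of r m] by (simp only: lin_def sum_distrib_right mult.assoc)
  finally show ?thesis .
qed

text \<open>An element of the dual leaves a normal remainder that is still in the dual; testing it
  with \<open>compl m\<close> isolates the coefficient at m, so the remainder is 0.\<close>

lemma K_eq_dual: "K = dual (- c)"
proof
  show "K \<subseteq> dual (- c)" using K'_subset_dual[of "- c"] by simp
  show "dual (- c) \<subseteq> K"
  proof
    fix p assume p: "p \<in> dual (- c)"
    then have "p \<in> carrier (poly_ring n)" by (simp add: dual_def)
    then obtain r where r: "keys r \<subseteq> {s \<in> normal. \<exists>m\<in>keys p. monom_degree s = monom_degree m}"
      "p - r \<in> K" by (rule reduce)
    have "p - (p - r) \<in> dual (- c)"
      by (rule poly_ideal_diff[OF dual_ideal p subsetD[OF K'_subset_dual]]) (use r(2) in simp)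
    then have "lin (\<lambda>k. wt (m + k)) r = 0" if "m \<in> monoms n" for m
      using that by (simp add: dual_def)
    then have "lookup r m = 0" if "m \<in> normal" for m
      using lin_wt_compl[of r m] r(1) that wt_compl_nonzero[OF that] compl_monoms[of m] by auto
    then have "r = 0" using r(1) by (intro poly_mapping_eqI) (auto simp: in_keys_iff)
    with r(2) show "p \<in> K" by simp
  qed
qed

lemma wt_degree:
  assumes "m \<in> monoms n" "wt m \<noteq> 0"
  shows "monom_degree m = top_degree"
proof -
  obtain q where q: "top_at q m" using top_weight_eq_0 assms(2) by blast
  then have "(- c) ^ (q - 1) \<noteq> 0" using top_weight_top[OF q, of "- c"] assms(2) by simp
  then have "c \<noteq> 0 \<or> q = 1" using top_at_pos[OF q] by (cases "c = 0") (auto simp: zero_power)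
  then show ?thesis using top_at_degree[OF assms(1) q] homog by auto
qed

lemma compl_degree:
  assumes "m \<in> normal"
  shows "monom_degree (compl m) + monom_degree m = top_degree"
  using wt_degree[OF _ wt_compl_nonzero[OF assms]] normal_monoms[OF assms] compl_monoms by simp

text \<open>Phi lives in the single degree \<open>top_degree\<close>, so homogeneous elements need
  testing only in the complementary degree.\<close>

lemma K_iff_wt:
  assumes "p \<in> poly_grading n i"
  shows "p \<in> K \<longleftrightarrow> (\<forall>m\<in>monoms n. monom_degree m + i = top_degree \<longrightarrow> lin (\<lambda>k. wt (m + k)) p = 0)"
proof -
  have "lin (\<lambda>k. wt (m + k)) p = 0" if "m \<in> monoms n" "monom_degree m + i \<noteq> top_degree" for m
  proof -
    have "wt (m + k) = 0" if k: "k \<in> keys p" for k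
    proof (rule ccontr)
      assume "wt (m + k) \<noteq> 0"
      moreover have "k \<in> monoms n" "monom_degree k = i"
        using assms k by (auto simp: poly_grading_def carrier_poly_ring)
      ultimately show False using wt_degree[of "m + k"] \<open>m \<in> monoms n\<close>
          \<open>monom_degree m + i \<noteq> top_degree\<close> by simp
    qed
    then show ?thesis by (simp add: lin_def)
  qed
  then show ?thesis using assms unfolding K_eq_dual dual_def poly_grading_def by blast
qed

end

section \<open>The Lefschetz property\<close>

lemma poly_grading_carrier: "p \<in> poly_grading n i \<Longrightarrow> p \<in> carrier (poly_ring n)"
  by (simp add: poly_grading_def)

lemma poly_grading_iff: "p \<in> poly_grading n i \<longleftrightarrow> keys p \<subseteq> {m \<in> monoms n. monom_degree m = i}"
  by (auto simp: poly_grading_def carrier_poly_ring)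

lemma poly_grading_single: "m \<in> monoms n \<Longrightarrow> monom_degree m = i \<Longrightarrow> single m a \<in> poly_grading n i"
  by (simp add: poly_grading_iff)

lemma poly_grading_0 [simp]: "0 \<in> poly_grading n i"
  by (simp add: poly_grading_iff)

lemma poly_grading_add:
  "p \<in> poly_grading n i \<Longrightarrow> q \<in> poly_grading n i \<Longrightarrow> p + q \<in> poly_grading n i"
  unfolding poly_grading_iff using keys_add[of p q] by blast

lemma poly_grading_sum:
  "(\<And>x. x \<in> A \<Longrightarrow> f x \<in> poly_grading n i) \<Longrightarrow> sum f A \<in> poly_grading n i"
  by (induction A rule: infinite_finite_induct) (auto intro: poly_grading_add)

lemma poly_grading_diff:
  "p \<in> poly_grading n i \<Longrightarrow> q \<in> poly_grading n i \<Longrightarrow> p - q \<in> poly_grading n i"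
  using poly_grading_add[of p n i "- q"] by (simp add: poly_grading_iff)

lemma poly_grading_mult:
  assumes "p \<in> poly_grading n i" "q \<in> poly_grading n j"
  shows "p * q \<in> poly_grading n (i + j)"
  unfolding poly_grading_iff
proof
  fix m assume "m \<in> keys (p * q)"
  then obtain a b where "a \<in> keys p" "b \<in> keys q" "m = a + b"
    using keys_mult[of p q] by auto
  then show "m \<in> {m \<in> monoms n. monom_degree m = i + j}"
    using assms unfolding poly_grading_iff by auto
qed

lemma poly_grading_power: "p \<in> poly_grading n 1 \<Longrightarrow> p ^ j \<in> poly_grading n j"
proof (induction j)
  case 0
  show ?case by (simp add: poly_grading_iff)
next
  case (Suc j)
  then show ?case using poly_grading_mult[of p n 1 "p ^ j" j] by simp
qed

lemma lin_times:
  assumes "finite T" "keys r \<subseteq> T"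
  shows "lin w (q * r) = (\<Sum>u\<in>T. lookup r u * lin (\<lambda>k. w (k + u)) q)"
proof -
  have r: "r = (\<Sum>u\<in>T. single u (lookup r u))"
  proof -
    have "(\<Sum>u\<in>keys r. single u (lookup r u)) = (\<Sum>u\<in>T. single u (lookup r u))"
      using assms by (intro sum.mono_neutral_left) (auto simp: in_keys_iff)
    then show ?thesis by (simp flip: sum_single)
  qed
  have "lin w (q * r) = lin w (\<Sum>u\<in>T. single u (lookup r u) * q)"
    by (subst (1) r, subst mult.commute) (simp only: sum_distrib_right)
  also have "\<dots> = (\<Sum>u\<in>T. lookup r u * lin (\<lambda>k. w (k + u)) q)"
    by (simp add: lin_sum lin_single_times add.commute)
  finally show ?thesis .
qed

definition weighted_varsum :: "nat \<Rightarrow> 'k \<Rightarrow> 'k::field mpoly" where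
  "weighted_varsum n t = (\<Sum>i\<in>{1..n}. const (if i = 1 then t else 1) * var i)"

lemma const_1 [simp]: "const 1 = 1"
  by (simp add: const_def)

lemma varsum_eq: "varsum n = weighted_varsum n 1"
  by (simp add: varsum_def weighted_varsum_def cong: if_cong)

lemma weighted_varsum_grading: "weighted_varsum n t \<in> poly_grading n 1"
  unfolding weighted_varsum_def
  by (intro poly_grading_sum)
    (simp add: const_def var_def mult_single poly_grading_iff)

lemma lookup_const_times:
  fixes p :: "'k::field mpoly"
  shows "lookup (const a * p) m = a * lookup p m"
  using lookup_single_times[of 0 a p m] by (simp add: const_def)

text \<open>The weighted form arises from the plain sum by substituting t x_1 for x_1, so each
  coefficient gains t to the x_1-exponent.\<close>

lemma lookup_weighted_varsum_power:
  fixes t :: "'k::field"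
  shows "lookup (weighted_varsum n t ^ j) m = t ^ lookup m 1 * lookup (varsum n ^ j) m"
proof (induction j arbitrary: m)
  case 0
  then show ?case by (auto simp: lookup_one when_def)
next
  case (Suc j)
  have "lookup (weighted_varsum n t ^ Suc j) m = (\<Sum>i\<in>{1..n}. (if i = 1 then t else 1) *
      (if lookup m i > 0 then lookup (weighted_varsum n t ^ j) (m - unit_exp i) else 0))"
    by (subst power_Suc, subst (1) weighted_varsum_def)
      (simp only: sum_distrib_right lookup_sum mult.assoc lookup_const_times lookup_var_times)
  also have "\<dots> = (\<Sum>i\<in>{1..n}. t ^ lookup m 1 *
      (if lookup m i > 0 then lookup (varsum n ^ j) (m - unit_exp i) else 0))"
  proof (rule sum.cong)
    fix i assume "i \<in> {1..n}"
    have "lookup m 1 = Suc (lookup (m - unit_exp 1) 1)" if "lookup m 1 > 0"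
      using that by (simp add: lookup_minus)
    moreover have "lookup (m - unit_exp i) 1 = lookup m 1" if "i \<noteq> 1"
      using that by (simp add: lookup_minus lookup_single_not_eq)
    ultimately show "(if i = 1 then t else 1) *
        (if lookup m i > 0 then lookup (weighted_varsum n t ^ j) (m - unit_exp i) else 0)
      = t ^ lookup m 1 * (if lookup m i > 0 then lookup (varsum n ^ j) (m - unit_exp i) else 0)"
      by (auto simp: Suc simp del: One_nat_def)
  qed simp
  also have "\<dots> = t ^ lookup m 1 * lookup (varsum n ^ Suc j) m"
    by (simp add: lookup_varsum_times sum_distrib_left)
  finally show ?case .
qed

section \<open>Injectivity on the monomial quotient at c = 0\<close>

context exponents
begin

lemma int_top_degree:
  assumes hom: "d 1 = (\<Sum>i\<in>{2..n}. \<alpha> i)"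
  shows "int top_degree = int (d 1) - int (\<alpha> 1) - 1 + (\<Sum>i\<in>{2..n}. int (d i) - 1)"
proof -
  have d2: "1 \<le> d i" if "i \<in> {2..n}" for i using that d_pos[of i] by simp
  have 1: "int (\<Sum>i\<in>{2..n}. d i - 1) = (\<Sum>i\<in>{2..n}. int (d i) - 1)"
    unfolding of_nat_sum using d2 by (intro sum.cong) (auto simp: of_nat_diff)
  have "\<alpha> 1 + 1 \<le> d 1 + (\<Sum>i\<in>{2..n}. d i - 1)"
  proof (cases "\<alpha> 1 < d 1")
    \<comment> \<open>Here \<alpha>_1 = d_1, and \<open>proper\<close> keeps the subtraction in
      \<open>top_degree\<close> from truncating.\<close>
    case False
    then have "\<alpha> i \<le> d i - 1" if "i \<in> {2..n}" for i using that proper by fastforce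
    then have "d 1 \<le> (\<Sum>i\<in>{2..n}. d i - 1)" unfolding hom by (intro sum_mono)
    then show ?thesis using d1_pos \<alpha>1_le by linarith
  qed simp
  then show ?thesis unfolding top_degree_def 1[symmetric] by linarith
qed

text \<open>The leading-term degeneration of the quotient is an extension of two monomial complete
  intersections whose Hilbert functions are symmetric about the same centre.\<close>

lemma monomial_lefschetz:
  fixes p :: "'k::field_char_0 mpoly"
  assumes hom: "d 1 = (\<Sum>i\<in>{2..n}. \<alpha> i)"
    and p: "keys p \<subseteq> {s \<in> normal. monom_degree s = i}"
    and 0: "\<And>w. w \<in> normal \<Longrightarrow> lookup (varsum n ^ j * p) w = 0"
    and le: "j + 2 * i \<le> top_degree"
  shows "p = 0"
proof -
  \<comment> \<open>The first box: the normal monomials that are not late, a basis of the quotient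
    by x_1^(d_1 - \<alpha>_1).\<close>
  define e where "e k = (if k = 1 then d 1 - \<alpha> 1 else d k)" for k
  have e1: "e (Suc 0) = d 1 - \<alpha> 1" and e2: "k \<in> {2..n} \<Longrightarrow> e k = d k" for k
    by (auto simp: e_def)
  have "lookup p m = 0" if m: "m \<in> box n e" for m
  proof (rule box_lefschetz[of p i n e j, OF _ _ _ m])
    show "monom_degree m = i" if "m \<in> keys p" for m using that p by blast
    show "lookup (varsum n ^ j * p) m = 0" if m: "m \<in> box n e" for m
    proof (rule 0)
      have "m \<in> monoms n" "lookup m 1 < d 1 - \<alpha> 1" "\<forall>k\<in>{2..n}. lookup m k < d k"
        using m unfolding box_def insert_1 by (auto simp: e_def)
      then show "m \<in> normal" unfolding normal_def insert_1 by auto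
    qed
    have "(\<Sum>k\<in>{1..n}. int (e k) - 1) = int top_degree"
      unfolding int_top_degree[OF hom] insert_1
      using e1 \<alpha>1_le by (simp add: e2 of_nat_diff)
    then show "int j + 2 * int i \<le> (\<Sum>k\<in>{1..n}. int (e k) - 1)" using le by simp
  qed
  then have p2: "m \<in> normal \<and> d 1 - \<alpha> 1 \<le> lookup m 1 \<and> monom_degree m = i" if "m \<in> keys p" for m
  proof -
    have m: "m \<in> normal" "monom_degree m = i" using p that by auto
    moreover have "m \<notin> box n e" using \<open>m \<in> box n e \<Longrightarrow> lookup p m = 0\<close> that by (auto simp: in_keys_iff)
    then have "\<not> lookup m 1 < d 1 - \<alpha> 1"
      using m(1) unfolding box_def normal_def insert_1 by (auto simp: e_def)
    ultimately show ?thesis by simp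
  qed
  \<comment> \<open>What remains of p is divisible by x_1^(d_1 - \<alpha>_1), so it can be divided
    out and the quotient studied on a second box.\<close>
  define a where "a = single (1 :: nat) (d 1 - \<alpha> 1)"
  have a: "a \<in> monoms n" "lookup a (Suc 0) = d 1 - \<alpha> 1" "monom_degree a = d 1 - \<alpha> 1"
    using n by (simp_all add: a_def)
  have a2: "lookup a k = 0" if "k \<in> {2..n}" for k
    using that by (simp add: a_def lookup_single_not_eq)
  define q where "q = (\<Sum>m\<in>keys p. single (m - a) (lookup p m))"
  have split: "m = a + (m - a)" if "m \<in> keys p" for m
    using p2[OF that] normal_monoms a(1)
    by (intro monoms_le[of _ n]) (auto simp: a_def lookup_single when_def)
  have pq: "p = single a 1 * q"
  proof -
    have "single a 1 * q = (\<Sum>m\<in>keys p. single (a + (m - a)) (lookup p m))"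
      by (simp add: q_def sum_distrib_left mult_single)
    also have "\<dots> = (\<Sum>m\<in>keys p. single m (lookup p m))"
      using split by (intro sum.cong) simp_all
    finally show ?thesis by (simp flip: sum_single)
  qed
  have lookup_q: "lookup q m = lookup p (a + m)" for m
    using lookup_single_times[of a 1 q m] pq by simp
  \<comment> \<open>The second box belongs to the annihilator of x_1^(d_1 - \<alpha>_1) in the
    monomial quotient, generated by x_1^(\<alpha>_1) and the x_k^(d_k - \<alpha>_k).\<close>
  define f where "f k = (if k = 1 then \<alpha> 1 else d k - \<alpha> k)" for k
  have f1: "f (Suc 0) = \<alpha> 1" and f2: "k \<in> {2..n} \<Longrightarrow> f k = d k - \<alpha> k" for k
    by (auto simp: f_def)
  have shift: "m \<in> box n f" if "m \<in> monoms n" "a + m \<in> normal" for m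
  proof -
    have "lookup m 1 < \<alpha> 1" using normal_less[OF that(2), of 1] n by (simp add: lookup_add a)
    moreover have "lookup m k < d k - \<alpha> k" if k: "k \<in> {2..n}" for k
    proof -
      have "late (a + m)" by (simp add: late_def lookup_add a)
      from late_less[OF \<open>a + m \<in> normal\<close> this k] show ?thesis
        by (simp add: lookup_add a2[OF k])
    qed
    ultimately show ?thesis unfolding box_def insert_1 using that(1) f1 f2 by auto
  qed
  have shift': "a + m \<in> normal" if "m \<in> box n f" for m
  proof -
    have m: "m \<in> monoms n" "lookup m 1 < \<alpha> 1" "\<And>k. k \<in> {2..n} \<Longrightarrow> lookup m k < d k - \<alpha> k"
      using that unfolding box_def insert_1 by (auto simp: f_def)
    have "lookup (a + m) 1 < d 1" using m(2) \<alpha>1_le by (simp add: lookup_add a)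
    moreover have "lookup (a + m) k + \<alpha> k < d k" if "k \<in> {2..n}" for k
      using m(3)[OF that] by (simp add: lookup_add a2[OF that])
    moreover from this have "lookup (a + m) k < d k" if "k \<in> {2..n}" for k
      using that by (meson add_lessD1)
    ultimately show ?thesis using m(1) a(1) unfolding normal_def insert_1 by auto
  qed
  show "p = 0"
  proof (rule ccontr)
    assume "p \<noteq> 0"
    then obtain m0 where m0: "m0 \<in> keys p" by (metis all_not_in_conv keys_eq_empty)
    have "monom_degree m0 = monom_degree a + monom_degree (m0 - a)"
      using split[OF m0] monom_degree_add[of a "m0 - a"] by simp
    then have i: "d 1 - \<alpha> 1 \<le> i" using p2[OF m0] a by linarith
    have keys_q: "a + m \<in> keys p" if "m \<in> keys q" for m
      using that by (simp add: in_keys_iff lookup_q)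
    have mon_q: "m \<in> monoms n" if "m \<in> keys q" for m
      using p2[OF keys_q[OF that]] normal_monoms by fastforce
    have "lookup q m = 0" if m: "m \<in> box n f" for m
    proof (rule box_lefschetz[of q "i - (d 1 - \<alpha> 1)" n f j, OF _ _ _ m])
      show "monom_degree m = i - (d 1 - \<alpha> 1)" if "m \<in> keys q" for m
        using p2[OF keys_q[OF that]] unfolding monom_degree_add a(3) by linarith
      show "lookup (varsum n ^ j * q) m = 0" if "m \<in> box n f" for m
      proof -
        have "lookup (single a 1 * (varsum n ^ j * q)) (a + m) = 0"
          using 0[OF shift'[OF that]] by (simp add: pq mult.left_commute)
        then show ?thesis by (simp add: lookup_single_times)
      qed
      have "(\<Sum>k\<in>{2..n}. int (f k) - 1) = (\<Sum>k\<in>{2..n}. (int (d k) - 1) - int (\<alpha> k))"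
      proof (rule sum.cong)
        fix k assume k: "k \<in> {2..n}"
        then have "\<alpha> k \<le> d k" using \<alpha>_le by simp
        then show "int (f k) - 1 = (int (d k) - 1) - int (\<alpha> k)"
          using f2[OF k] by (simp add: of_nat_diff)
      qed simp
      also have "\<dots> = (\<Sum>k\<in>{2..n}. int (d k) - 1) - int (d 1)"
        unfolding sum_subtractf hom by simp
      \<comment> \<open>Equal centres: the socle degree of the second box falls short of
        \<open>top_degree\<close> by exactly twice the shift.\<close>
      finally have "(\<Sum>k\<in>{1..n}. int (f k) - 1) = int top_degree - 2 * int (d 1 - \<alpha> 1)"
        unfolding int_top_degree[OF hom] insert_1 using f1 \<alpha>1_le by (simp add: of_nat_diff)
      then show "int j + 2 * int (i - (d 1 - \<alpha> 1)) \<le> (\<Sum>k\<in>{1..n}. int (f k) - 1)"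
        using le i by (simp add: of_nat_diff)
    qed
    moreover have "m0 - a \<in> box n f"
      using split[OF m0] p2[OF m0] normal_monoms by (intro shift) auto
    ultimately have "lookup p m0 = 0" using split[OF m0] lookup_q[of "m0 - a"] by simp
    with m0 show False by (simp add: in_keys_iff)
  qed
qed

section \<open>The normalised pairing matrix as a polynomial in z\<close>

definition late_exp :: "(nat \<Rightarrow>\<^sub>0 nat) \<Rightarrow> nat" where
  "late_exp v = (if late v then 1 else 0)"

text \<open>The weight of \<open>m + v\<close> as a polynomial in \<open>z\<close>, divided by the weight of \<open>compl v + v\<close>:
  the quotient still makes sense at \<open>z = 0\<close>, where it picks out \<open>m = compl v\<close>.\<close>

definition weight_poly :: "(nat \<Rightarrow>\<^sub>0 nat) \<Rightarrow> (nat \<Rightarrow>\<^sub>0 nat) \<Rightarrow> 'k::field poly" where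
  "weight_poly v m = (let q = (lookup (m + v) 1 + \<alpha> 1 + 1) div d 1 in
     if top_at q (m + v) then Polynomial.monom 1 (q - 1 - late_exp v) else 0)"

lemma weight_poly_top:
  assumes "top_at q (m + v)"
  shows "weight_poly v m = Polynomial.monom 1 (q - 1 - late_exp v)"
proof -
  have "(lookup (m + v) 1 + \<alpha> 1 + 1) div d 1 = q"
    unfolding top_atD(1)[OF assms] using d1_pos by simp
  with assms show ?thesis by (simp add: weight_poly_def Let_def del: One_nat_def)
qed

lemma weight_poly_eq_0: "(\<And>q. \<not> top_at q (m + v)) \<Longrightarrow> weight_poly v m = 0"
  by (simp add: weight_poly_def Let_def)

lemma late_exp_le: "top_at q (m + v) \<Longrightarrow> late_exp v \<le> q - 1"
  using late_level[of q m v] by (auto simp: late_exp_def)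

lemma poly_weight_poly: "z ^ late_exp v * poly (weight_poly v m) z = top_weight z (m + v)"
proof (cases "\<exists>q. top_at q (m + v)")
  case True
  then obtain q where q: "top_at q (m + v)" by blast
  have "z ^ late_exp v * poly (Polynomial.monom 1 k) z = z ^ (late_exp v + k)" for k
    by (simp add: poly_monom power_add)
  moreover have "late_exp v + (q - 1 - late_exp v) = q - 1" using late_exp_le[OF q] by simp
  ultimately show ?thesis unfolding weight_poly_top[OF q] top_weight_top[OF q] by metis
next
  case False
  then show ?thesis by (simp add: weight_poly_eq_0 top_weight_eq_0)
qed

text \<open>At z = 0 only the lowest level open to v survives, and a top monomial is determined by
  its level.\<close>

lemma poly_weight_poly_0:
  assumes "v \<in> normal" "m \<in> monoms n"
  shows "poly (weight_poly v m) 0 = of_bool (m = compl v)"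
proof (cases "m = compl v")
  case True
  then show ?thesis
    by (simp add: weight_poly_top[OF top_at_compl[OF assms(1)]] poly_monom late_exp_def)
next
  case False
  show ?thesis
  proof (cases "\<exists>q. top_at q (m + v)")
    case True
    then obtain q where q: "top_at q (m + v)" by blast
    have "q \<noteq> (if late v then 2 else 1)"
      using compl_unique[OF assms] q False by blast
    then have "q - 1 - late_exp v \<noteq> 0"
      using late_exp_le[OF q] top_at_pos[OF q] by (auto simp: late_exp_def split: if_splits)
    then show ?thesis using False by (simp add: weight_poly_top[OF q] poly_monom zero_power)
  next
    case False
    with \<open>m \<noteq> compl v\<close> show ?thesis by (simp add: weight_poly_eq_0)
  qed
qed

text \<open>At level q the power of t is q d_1, and t^(q d_1) z^(q - 1) = t^(d_1) (z t^(d_1))^(q -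
  1): scaling x_1 replaces z by z t^(d_1).\<close>

lemma top_weight_scale:
  "t ^ (lookup m 1 + \<alpha> 1 + 1) * top_weight z m = t ^ d 1 * top_weight (z * t ^ d 1) m"
proof (cases "\<exists>q. top_at q m")
  case True
  then obtain q where q: "top_at q m" by blast
  have "t ^ (q * d 1) = (t ^ d 1) ^ q" by (simp only: mult.commute[of q] power_mult)
  also have "\<dots> = t ^ d 1 * (t ^ d 1) ^ (q - 1)"
    using top_at_pos[OF q] by (cases q) simp_all
  finally show ?thesis
    unfolding top_atD(1)[OF q] top_weight_top[OF q] by (simp add: power_mult_distrib)
next
  case False
  then show ?thesis by (simp add: top_weight_eq_0)
qed

text \<open>The entries Phi(L^j x^u x^v) for L = x_1 + ... + x_n as polynomials in z, with late rows
  v divided by z; the matrix is therefore not symmetric in general.\<close>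

definition hessian :: "nat \<Rightarrow> (nat \<Rightarrow>\<^sub>0 nat) \<Rightarrow> (nat \<Rightarrow>\<^sub>0 nat) \<Rightarrow> 'k::field poly" where
  "hessian j v u = (\<Sum>k\<in>keys (varsum n ^ j :: 'k mpoly).
     Polynomial.smult (lookup (varsum n ^ j) k) (weight_poly v (k + u)))"

lemma varsum_power_monoms: "keys (varsum n ^ j :: 'k::field mpoly) \<subseteq> monoms n"
  using poly_grading_power[OF weighted_varsum_grading[of n "1 :: 'k"], of j]
  unfolding varsum_eq poly_grading_iff by blast

text \<open>The limit matrix is that of multiplication by L^j between normal monomials, its rows
  relabelled by \<open>compl\<close>.\<close>

lemma poly_hessian_0:
  assumes "v \<in> normal" "u \<in> normal"
  shows "poly (hessian j v u) 0 = lookup (varsum n ^ j * single u 1) (compl v)"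
proof -
  have "poly (hessian j v u) 0 = lin (\<lambda>k. of_bool (k + u = compl v)) (varsum n ^ j)"
    unfolding hessian_def poly_sum lin_def poly_smult
    using varsum_power_monoms normal_monoms[OF assms(2)]
    by (intro sum.cong refl arg_cong2[of _ _ _ _ "(*)"] poly_weight_poly_0 assms(1)) auto
  also have "\<dots> = lookup (varsum n ^ j * single u 1) (compl v)"
    unfolding lookup_eq_lin mult.commute[of _ "single u 1"] lin_single_times
    by (simp add: add.commute)
  finally show ?thesis .
qed

text \<open>Apart from factors depending on u and v separately, the pairing matrix of the scaled
  form at z is the hessian at z t^(d_1). The factors are nonzero for z \<noteq> 0, so nonsingularity
  carries over.\<close>

lemma hessian_scale:
  fixes t z :: "'k::field"
  assumes t: "t \<noteq> 0"
  shows "t ^ (lookup u 1 + lookup v 1 + \<alpha> 1 + 1) *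
      lin (\<lambda>k. top_weight z (k + u + v)) (weighted_varsum n t ^ j)
    = t ^ d 1 * (z * t ^ d 1) ^ late_exp v * poly (hessian j v u) (z * t ^ d 1)"
proof -
  let ?L = "varsum n ^ j :: 'k mpoly"
  have "lin (\<lambda>k. top_weight z (k + u + v)) (weighted_varsum n t ^ j)
      = (\<Sum>k\<in>keys ?L. lookup (weighted_varsum n t ^ j) k * top_weight z (k + u + v))"
    by (rule lin_superset) (auto simp: in_keys_iff lookup_weighted_varsum_power)
  also have "t ^ (lookup u 1 + lookup v 1 + \<alpha> 1 + 1) * \<dots>
      = (\<Sum>k\<in>keys ?L. lookup ?L k * (t ^ (lookup (k + u + v) 1 + \<alpha> 1 + 1) * top_weight z (k + u + v)))"
    unfolding sum_distrib_left
    by (intro sum.cong refl) (simp add: lookup_weighted_varsum_power lookup_add power_add)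
  also have "\<dots> = (\<Sum>k\<in>keys ?L. lookup ?L k * (t ^ d 1 * ((z * t ^ d 1) ^ late_exp v *
      poly (weight_poly v (k + u)) (z * t ^ d 1))))"
    unfolding top_weight_scale poly_weight_poly ..
  also have "\<dots> = t ^ d 1 * (z * t ^ d 1) ^ late_exp v * poly (hessian j v u) (z * t ^ d 1)"
    unfolding hessian_def poly_sum poly_smult sum_distrib_left
    by (intro sum.cong refl) (simp only: ac_simps)
  finally show ?thesis .
qed

end

section \<open>Maximal rank for a suitable scale t\<close>

locale lefschetz_exponents = exponents_coeff n d \<alpha> c
  for n d \<alpha> and c :: "'k::field_char_0" +
  assumes c_nonzero: "c \<noteq> 0"
begin

lemma hom: "d 1 = (\<Sum>i\<in>{2..n}. \<alpha> i)"
  using homog c_nonzero by simp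

definition normal_degree :: "nat \<Rightarrow> (nat \<Rightarrow>\<^sub>0 nat) set" where
  "normal_degree i = {s \<in> normal. monom_degree s = i}"

lemma finite_normal_degree: "finite (normal_degree i)"
  using finite_normal by (simp add: normal_degree_def)

lemma hessian_generic:
  assumes ij: "2 * i + j = top_degree"
  obtains B :: "'k set" where "finite B"
    and "\<And>z y. z \<notin> B \<Longrightarrow> \<exists>x. \<forall>v\<in>normal_degree i.
      (\<Sum>u\<in>normal_degree i. poly (hessian j v u) z * x u) = y v"
    and "\<And>z x. z \<notin> B \<Longrightarrow> (\<And>v. v \<in> normal_degree i \<Longrightarrow>
      (\<Sum>u\<in>normal_degree i. poly (hessian j v u) z * x u) = 0) \<Longrightarrow> \<forall>u\<in>normal_degree i. x u = 0"
proof (rule generic_nonsingular[OF finite_normal_degree, of i "hessian j"])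
  fix x :: "_ \<Rightarrow> 'k"
  assume x: "\<And>v. v \<in> normal_degree i \<Longrightarrow> (\<Sum>u\<in>normal_degree i. poly (hessian j v u) 0 * x u) = 0"
  define p where "p = (\<Sum>u\<in>normal_degree i. single u (x u))"
  have lookup_p: "lookup p u = (if u \<in> normal_degree i then x u else 0)" for u
    using finite_normal_degree
    by (simp add: p_def lookup_sum lookup_single when_def sum.delta')
  have p: "p \<in> poly_grading n i"
    unfolding p_def
    by (intro poly_grading_sum poly_grading_single) (auto simp: normal_degree_def normal_monoms)
  have "lookup (varsum n ^ j * p) w = 0" if w: "w \<in> normal" for w
  proof (cases "monom_degree w = j + i")
    case True
    \<comment> \<open>In degree i + j every normal w is the complement of a normal v of degree i,
      because 2i + j is the top degree; its coefficient is then a row sum of the matrix.\<close>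
    define v where "v = compl w"
    have v: "v \<in> normal_degree i" "compl v = w"
      using compl_normal[OF w] compl_degree[OF w] compl_compl[OF w] True ij
      by (auto simp: v_def normal_degree_def)
    have "varsum n ^ j * p = (\<Sum>u\<in>normal_degree i. single 0 (x u) * (varsum n ^ j * single u 1))"
      by (simp add: p_def sum_distrib_left mult_single mult.left_commute[of "single 0 _"])
    then have "lookup (varsum n ^ j * p) w
        = (\<Sum>u\<in>normal_degree i. x u * lookup (varsum n ^ j * single u 1) (compl v))"
      by (simp add: lookup_sum v(2) lookup_const_times[unfolded const_def])
    also have "\<dots> = (\<Sum>u\<in>normal_degree i. poly (hessian j v u) 0 * x u)"
      using v(1) by (intro sum.cong) (auto simp: poly_hessian_0 normal_degree_def)
    finally show ?thesis using x[OF v(1)] by simp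
  next
    case False
    have "varsum n ^ j * p \<in> poly_grading n (j + i)"
      unfolding varsum_eq by (intro poly_grading_mult poly_grading_power weighted_varsum_grading p)
    then show ?thesis using False by (auto simp: poly_grading_iff in_keys_iff)
  qed
  then have "p = 0"
    using ij by (intro monomial_lefschetz[OF hom, of p i j])
      (auto simp: in_keys_iff lookup_p normal_degree_def split: if_splits)
  then show "\<forall>u\<in>normal_degree i. x u = 0" using lookup_p by (metis lookup_zero)
qed (use that in blast)

lemma K_multiply: "p \<in> K \<Longrightarrow> q \<in> carrier (poly_ring n) \<Longrightarrow> q * p \<in> K"
  by (rule poly_ideal_mult[OF K_ideal])

lemma lin_wt_K: "p \<in> K \<Longrightarrow> m \<in> monoms n \<Longrightarrow> lin (\<lambda>k. wt (m + k)) p = 0"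
  unfolding K_eq_dual dual_def by blast

text \<open>Normal monomials of degree i serve twice: they span degree i, and through Phi they test
  degree i + j, which is complementary to i. So one nonsingular square matrix gives both injectivity
  and surjectivity.\<close>

lemma lefschetz_degree:
  assumes ij: "2 * i + j = top_degree" and t: "t \<noteq> 0"
    and surj: "\<And>y. \<exists>x. \<forall>v\<in>normal_degree i.
      (\<Sum>u\<in>normal_degree i. poly (hessian j v u) (- c * t ^ d 1) * x u) = y v"
    and inj: "\<And>x. (\<And>v. v \<in> normal_degree i \<Longrightarrow>
      (\<Sum>u\<in>normal_degree i. poly (hessian j v u) (- c * t ^ d 1) * x u) = 0) \<Longrightarrow>
      \<forall>u\<in>normal_degree i. x u = 0"
  shows "p \<in> poly_grading n i \<Longrightarrow> weighted_varsum n t ^ j * p \<in> K \<Longrightarrow> p \<in> K"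
    and "y \<in> poly_grading n (i + j) \<Longrightarrow> \<exists>p\<in>poly_grading n i. weighted_varsum n t ^ j * p - y \<in> K"
proof -
  let ?l = "weighted_varsum n t ^ j"
  let ?T = "normal_degree i"
  let ?z = "- c * t ^ d 1"
  have l: "?l \<in> poly_grading n j" by (intro poly_grading_power weighted_varsum_grading)
  \<comment> \<open>Column and row factors from \<open>hessian_scale\<close>, nonzero because t and
    c are.\<close>
  define a where "a u = inverse (t ^ lookup u 1)" for u :: "nat \<Rightarrow>\<^sub>0 nat"
  define b where "b v = t ^ d 1 * ?z ^ late_exp v / t ^ (lookup v 1 + \<alpha> 1 + 1)" for v
  have a: "a u \<noteq> 0" and b: "b u \<noteq> 0" for u
    using t c_nonzero by (auto simp: a_def b_def)
  have H: "lin (\<lambda>k. wt (k + u + v)) ?l = a u * b v * poly (hessian j v u) ?z" for u v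
    using hessian_scale[OF t, of u v "- c" j] t
    by (simp add: a_def b_def power_add field_simps)
  have pairing: "lin (\<lambda>k. wt (v + k)) (?l * r) = b v * (\<Sum>u\<in>?T. poly (hessian j v u) ?z * (a u * lookup r u))"
    if "keys r \<subseteq> ?T" for r v
  proof -
    have "lin (\<lambda>k. wt (v + k)) (?l * r) = (\<Sum>u\<in>?T. lookup r u * lin (\<lambda>k. wt (v + (k + u))) ?l)"
      by (rule lin_times[OF finite_normal_degree that])
    also have "\<dots> = (\<Sum>u\<in>?T. lookup r u * lin (\<lambda>k. wt (k + u + v)) ?l)"
      by (simp add: add_ac)
    also have "\<dots> = b v * (\<Sum>u\<in>?T. poly (hessian j v u) ?z * (a u * lookup r u))"
      unfolding H sum_distrib_left by (intro sum.cong refl) (simp only: ac_simps)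
    finally show ?thesis .
  qed
  have reduce_degree: "\<exists>r. keys r \<subseteq> ?T \<and> p - r \<in> K" if p: "p \<in> poly_grading n i" for p
  proof -
    obtain r where r: "keys r \<subseteq> {s \<in> normal. \<exists>m\<in>keys p. monom_degree s = monom_degree m}" "p - r \<in> K"
      by (rule reduce[OF poly_grading_carrier[OF p]])
    moreover have "keys r \<subseteq> ?T"
      using r(1) p unfolding poly_grading_iff normal_degree_def by fastforce
    ultimately show ?thesis by blast
  qed
  show "p \<in> K" if p: "p \<in> poly_grading n i" and lp: "?l * p \<in> K" for p
  proof -
    obtain r where r: "keys r \<subseteq> ?T" "p - r \<in> K" using reduce_degree[OF p] by blast
    have "?l * p - ?l * (p - r) \<in> K"
      by (intro poly_ideal_diff[OF K_ideal lp] K_multiply r(2) poly_grading_carrier[OF l])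
    then have lr: "?l * r \<in> K" by (simp add: right_diff_distrib)
    have "\<forall>u\<in>?T. a u * lookup r u = 0"
    proof (rule inj)
      fix v assume "v \<in> ?T"
      then have "v \<in> monoms n" by (simp add: normal_degree_def normal_monoms)
      from lin_wt_K[OF lr this]
      show "(\<Sum>u\<in>?T. poly (hessian j v u) ?z * (a u * lookup r u)) = 0"
        unfolding pairing[OF r(1)] using b by simp
    qed
    then have "\<forall>u\<in>?T. lookup r u = 0" using a by simp
    then have "r = 0" using r(1) by (intro poly_mapping_eqI) (auto simp: in_keys_iff)
    then show ?thesis using r(2) by simp
  qed
  show "\<exists>p\<in>poly_grading n i. ?l * p - y \<in> K" if y: "y \<in> poly_grading n (i + j)" for y
  proof -
    obtain x where x: "\<forall>v\<in>?T. (\<Sum>u\<in>?T. poly (hessian j v u) ?z * x u) = lin (\<lambda>k. wt (v + k)) y / b v"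
      using surj[of "\<lambda>v. lin (\<lambda>k. wt (v + k)) y / b v"] by blast
    define p where "p = (\<Sum>u\<in>?T. single u (x u / a u))"
    have lookup_p: "lookup p u = (if u \<in> ?T then x u / a u else 0)" for u
      using finite_normal_degree by (simp add: p_def lookup_sum lookup_single when_def sum.delta')
    have keys_p: "keys p \<subseteq> ?T" by (auto simp: in_keys_iff lookup_p split: if_splits)
    have p: "p \<in> poly_grading n i"
      unfolding p_def
      by (intro poly_grading_sum poly_grading_single) (auto simp: normal_degree_def normal_monoms)
    let ?g = "?l * p - y"
    have g: "?g \<in> poly_grading n (i + j)"
      using poly_grading_mult[OF l p] y by (intro poly_grading_diff) (simp_all add: add.commute)
    have lin_diff: "lin w ?g = lin w (?l * p) - lin w y" for w :: "_ \<Rightarrow> 'k"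
      using lin_add[of w ?g y] by simp
    have gT: "lin (\<lambda>k. wt (v + k)) ?g = 0" if "v \<in> ?T" for v
    proof -
      have "lin (\<lambda>k. wt (v + k)) (?l * p) = b v * (\<Sum>u\<in>?T. poly (hessian j v u) ?z * x u)"
        unfolding pairing[OF keys_p] using a
        by (intro arg_cong2[of _ _ _ _ "(*)"] sum.cong refl) (simp add: lookup_p)
      also have "\<dots> = lin (\<lambda>k. wt (v + k)) y" using x b that by simp
      finally show ?thesis by (simp add: lin_diff)
    qed
    have "?g \<in> K"
      unfolding K_iff_wt[OF g]
    proof (intro ballI impI)
      fix m assume m: "m \<in> monoms n" "monom_degree m + (i + j) = top_degree"
      \<comment> \<open>So far the vanishing is known for normal tests only; any monomial of degree
        i is replaced by its normal form modulo K.\<close>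
      then have "single m 1 \<in> poly_grading n i" using ij by (intro poly_grading_single) auto
      then obtain r where r: "keys r \<subseteq> ?T" "single m 1 - r \<in> K"
        using reduce_degree by blast
      have "?g * (single m 1 - r) \<in> K"
        by (intro K_multiply r(2) poly_grading_carrier[OF g])
      then have "lin wt (?g * (single m 1 - r)) = 0"
        using lin_wt_K[of _ 0] by simp
      moreover have "lin wt (?g * r) = 0"
        unfolding lin_times[OF finite_normal_degree r(1)]
        by (intro sum.neutral ballI) (simp add: gT flip: add.commute[of _ "_ :: nat \<Rightarrow>\<^sub>0 nat"])
      moreover have "lin wt (?g * single m 1) = lin (\<lambda>k. wt (m + k)) ?g"
        unfolding mult.commute[of ?g] lin_single_times by simp
      moreover have "lin wt (?g * single m 1) = lin wt (?g * (single m 1 - r)) + lin wt (?g * r)"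
        unfolding lin_add[symmetric] by (simp only: distrib_left[symmetric] diff_add_cancel)
      ultimately show "lin (\<lambda>k. wt (m + k)) ?g = 0" by simp
    qed
    with p show ?thesis by blast
  qed
qed

text \<open>In characteristic 0 the values -c (k + 1)^(d_1) for natural k are pairwise distinct as
  d_1 > 0, so one of them lies outside B.\<close>

lemma ex_good_scale:
  fixes B :: "'k set"
  assumes "finite B"
  obtains t :: 'k where "t \<noteq> 0" "- c * t ^ d 1 \<notin> B"
proof -
  define f where "f k = - c * (of_nat (Suc k) :: 'k) ^ d 1" for k
  have "inj f"
  proof (rule injI)
    fix a b assume "f a = f b"
    then have "of_nat (Suc a ^ d 1) = (of_nat (Suc b ^ d 1) :: 'k)"
      using c_nonzero by (simp add: f_def del: of_nat_Suc)
    then have "Suc a ^ d 1 = Suc b ^ d 1" by (simp only: of_nat_eq_iff)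
    then show "a = b" using d1_pos power_eq_imp_eq_base[of "Suc a" "d 1" "Suc b"] by simp
  qed
  then have "infinite (range f)" by (simp add: finite_image_iff)
  then obtain k where "f k \<notin> B" using assms by (meson finite_subset image_subset_iff rangeI subsetI)
  then show ?thesis by (intro that[of "of_nat (Suc k)"]) (simp_all add: f_def del: of_nat_Suc)
qed

lemma lefschetz_pairs:
  obtains l where "l \<in> poly_grading n 1"
    and "\<And>i j p. 2 * i + j = top_degree \<Longrightarrow> p \<in> poly_grading n i \<Longrightarrow> l ^ j * p \<in> K \<Longrightarrow> p \<in> K"
    and "\<And>i j y. 2 * i + j = top_degree \<Longrightarrow> y \<in> poly_grading n (i + j) \<Longrightarrow>
      \<exists>p\<in>poly_grading n i. l ^ j * p - y \<in> K"
proof -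
  define good :: "nat \<Rightarrow> 'k set \<Rightarrow> bool" where "good i B \<longleftrightarrow> finite B \<and> (\<forall>z. z \<notin> B \<longrightarrow>
      (\<forall>y. \<exists>x. \<forall>v\<in>normal_degree i.
        (\<Sum>u\<in>normal_degree i. poly (hessian (top_degree - 2 * i) v u) z * x u) = y v) \<and>
      (\<forall>x. (\<forall>v\<in>normal_degree i.
        (\<Sum>u\<in>normal_degree i. poly (hessian (top_degree - 2 * i) v u) z * x u) = 0) \<longrightarrow>
        (\<forall>u\<in>normal_degree i. x u = 0)))" for i B
  have "\<exists>B. good i B" if "2 * i \<le> top_degree" for i
    by (rule hessian_generic[of i "top_degree - 2 * i"]) (use that in \<open>auto simp: good_def\<close>)
  then have "\<forall>i\<in>{i. 2 * i \<le> top_degree}. \<exists>B. good i B" by blast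
  from bchoice[OF this] obtain B where B: "\<forall>i\<in>{i. 2 * i \<le> top_degree}. good i (B i)" ..
  \<comment> \<open>Finitely many degrees lie at or below the middle, so a single t can avoid all
    exceptional sets.\<close>
  have "finite {i. 2 * i \<le> top_degree}"
    by (rule finite_subset[of _ "{..top_degree}"]) auto
  then have "finite (\<Union>i\<in>{i. 2 * i \<le> top_degree}. B i)" using B by (auto simp: good_def)
  then obtain t where t: "t \<noteq> 0" "- c * t ^ d 1 \<notin> (\<Union>i\<in>{i. 2 * i \<le> top_degree}. B i)"
    by (rule ex_good_scale)
  have good: "good i (B i)" "- c * t ^ d 1 \<notin> B i" "top_degree - 2 * i = j"
    if "2 * i + j = top_degree" for i j
    using B t(2) that by auto
  show ?thesis
  proof (rule that[of "weighted_varsum n t"])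
    show "weighted_varsum n t \<in> poly_grading n 1" by (rule weighted_varsum_grading)
  next
    fix i j and p :: "'k mpoly" assume ij: "2 * i + j = top_degree" and p: "p \<in> poly_grading n i"
      "weighted_varsum n t ^ j * p \<in> K"
    show "p \<in> K"
      by (rule lefschetz_degree(1)[OF ij t(1) _ _ p]) (use good[OF ij] in \<open>auto simp: good_def\<close>)
  next
    fix i j and y :: "'k mpoly" assume ij: "2 * i + j = top_degree" and y: "y \<in> poly_grading n (i + j)"
    show "\<exists>p\<in>poly_grading n i. weighted_varsum n t ^ j * p - y \<in> K"
      by (rule lefschetz_degree(2)[OF ij t(1) _ _ y]) (use good[OF ij] in \<open>auto simp: good_def\<close>)
  qed
qed

text \<open>If 2i + j is at most the top degree, the map is the first factor of the injection from
  degree i to its symmetric degree. Beyond that, the surjection onto degree i + j from its symmetric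
  degree factors through degree i. Above the top degree the target is zero.\<close>

lemma maximal_rank:
  obtains l where "l \<in> poly_grading n 1"
    and "\<And>i j. (\<forall>p\<in>poly_grading n i. l ^ j * p \<in> K \<longrightarrow> p \<in> K) \<or>
      (\<forall>y\<in>poly_grading n (i + j). \<exists>p\<in>poly_grading n i. l ^ j * p - y \<in> K)"
proof -
  obtain l where l: "l \<in> poly_grading n 1"
    and inj: "\<And>i j p. 2 * i + j = top_degree \<Longrightarrow> p \<in> poly_grading n i \<Longrightarrow> l ^ j * p \<in> K \<Longrightarrow> p \<in> K"
    and surj: "\<And>i j y. 2 * i + j = top_degree \<Longrightarrow> y \<in> poly_grading n (i + j) \<Longrightarrow>
      \<exists>p\<in>poly_grading n i. l ^ j * p - y \<in> K"
    by (rule lefschetz_pairs) blast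
  have lc: "l ^ k \<in> carrier (poly_ring n)" for k
    using l by (intro power_carrier poly_grading_carrier)
  show ?thesis
  proof (rule that[OF l])
    fix i j
    consider "2 * i + j \<le> top_degree" | "top_degree < 2 * i + j" "i + j \<le> top_degree" | "top_degree < i + j"
      by linarith
    then show "(\<forall>p\<in>poly_grading n i. l ^ j * p \<in> K \<longrightarrow> p \<in> K) \<or>
      (\<forall>y\<in>poly_grading n (i + j). \<exists>p\<in>poly_grading n i. l ^ j * p - y \<in> K)"
    proof cases
      case 1
      define k where "k = top_degree - (2 * i + j)"
      have "p \<in> K" if "p \<in> poly_grading n i" "l ^ j * p \<in> K" for p :: "'k mpoly"
      proof (rule inj[OF _ that(1)])
        show "2 * i + (k + j) = top_degree" using 1 by (simp add: k_def)
        show "l ^ (k + j) * p \<in> K"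
          using K_multiply[OF that(2) lc[of k]] by (simp add: power_add mult.assoc)
      qed
      then show ?thesis by blast
    next
      case 2
      define i' where "i' = top_degree - (i + j)"
      define k where "k = 2 * i + j - top_degree"
      have "\<exists>p\<in>poly_grading n i. l ^ j * p - y \<in> K" if "y \<in> poly_grading n (i + j)" for y :: "'k mpoly"
      proof -
        have e: "2 * i' + (j + k) = top_degree" "i' + (j + k) = i + j" "k + i' = i"
          using 2 by (auto simp: i'_def k_def)
        obtain q where q: "q \<in> poly_grading n i'" "l ^ (j + k) * q - y \<in> K"
          using surj[OF e(1), of y] \<open>y \<in> poly_grading n (i + j)\<close> unfolding e(2) by blast
        have "l ^ k * q \<in> poly_grading n i"
          using poly_grading_mult[OF poly_grading_power[OF l, of k] q(1)] \<open>k + i' = i\<close> by simp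
        with q(2) show ?thesis
          by (intro bexI[of _ "l ^ k * q"]) (simp_all add: power_add mult.assoc)
      qed
      then show ?thesis by blast
    next
      case 3
      have "y \<in> K" if "y \<in> poly_grading n (i + j)" for y :: "'k mpoly"
        using 3 by (simp add: K_iff_wt[OF that])
      then have "l ^ j * 0 - y \<in> K" if "y \<in> poly_grading n (i + j)" for y :: "'k mpoly"
        using that poly_ideal_uminus[OF K_ideal] by simp
      then show ?thesis using poly_grading_0 by blast
    qed
  qed
qed

end

section \<open>Quotients of the polynomial ring\<close>

lemma poly_grading_degree_0: "p \<in> poly_grading n 0 \<longleftrightarrow> (\<exists>a. p = const a)"
proof
  assume p: "p \<in> poly_grading n 0"
  then have k: "keys p \<subseteq> {0}" by (auto simp: poly_grading_iff monom_degree_eq_0)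
  have "p = single 0 (lookup p 0)"
  proof (rule poly_mapping_eqI)
    fix m
    show "lookup p m = lookup (single 0 (lookup p 0)) m"
      using k by (cases "m = 0") (auto simp: lookup_single when_def in_keys_iff)
  qed
  then show "\<exists>a. p = const a" unfolding const_def ..
qed (auto simp: const_def poly_grading_iff split: if_splits)

text \<open>An arbitrary surjective image of the polynomial ring, since \<open>gorenstein\<close>
  speaks of a quotient of a quotient; statements about Q become membership in I.\<close>

locale poly_quotient = ring_hom_ring "poly_ring n" Q h
  for n and Q :: "('a, 'b) ring_scheme" and h :: "'k::field mpoly \<Rightarrow> 'a" +
  fixes I :: "'k mpoly set"
  assumes cring_Q: "cring Q"
    and surj: "h ` carrier (poly_ring n) = carrier Q"
    and ker: "p \<in> carrier (poly_ring n) \<Longrightarrow> h p = \<zero>\<^bsub>Q\<^esub> \<longleftrightarrow> p \<in> I"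
begin

lemma h_carrier: "p \<in> carrier (poly_ring n) \<Longrightarrow> h p \<in> carrier Q"
  using surj by blast

lemma h_mult: "p \<in> carrier (poly_ring n) \<Longrightarrow> q \<in> carrier (poly_ring n) \<Longrightarrow> h (p * q) = h p \<otimes>\<^bsub>Q\<^esub> h q"
  using hom_mult[of p q] by simp

lemma h_add: "p \<in> carrier (poly_ring n) \<Longrightarrow> q \<in> carrier (poly_ring n) \<Longrightarrow> h (p + q) = h p \<oplus>\<^bsub>Q\<^esub> h q"
  using hom_add[of p q] by simp

lemma h_zero: "h 0 = \<zero>\<^bsub>Q\<^esub>"
  using hom_zero by simp

lemma h_power: "p \<in> carrier (poly_ring n) \<Longrightarrow> h (p ^ (k :: nat)) = h p [^]\<^bsub>Q\<^esub> k"
proof (induction k)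
  case 0
  then show ?case using hom_one by simp
next
  case (Suc k)
  then show ?case using h_mult[of "p ^ k" p] by (simp add: mult.commute)
qed

lemma h_eq_iff:
  assumes "p \<in> carrier (poly_ring n)" "q \<in> carrier (poly_ring n)"
  shows "h p = h q \<longleftrightarrow> p - q \<in> I"
proof -
  have "h (p - q) \<oplus>\<^bsub>Q\<^esub> h q = h p"
    using h_add[of "p - q" q] assms by simp
  moreover have "\<zero>\<^bsub>Q\<^esub> \<oplus>\<^bsub>Q\<^esub> h q = h q" using h_carrier[OF assms(2)] by simp
  ultimately have "h p = h q \<longleftrightarrow> h (p - q) = \<zero>\<^bsub>Q\<^esub>"
    using S.add.right_cancel[of "h q" "h (p - q)" "\<zero>\<^bsub>Q\<^esub>"] h_carrier assms by simp
  then show ?thesis using ker[of "p - q"] assms by simp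
qed

lemma strong_lefschetz_image:
  assumes l: "l \<in> poly_grading n 1"
    and rank: "\<And>i j. (\<forall>p\<in>poly_grading n i. l ^ j * p \<in> I \<longrightarrow> p \<in> I) \<or>
      (\<forall>y\<in>poly_grading n (i + j). \<exists>p\<in>poly_grading n i. l ^ j * p - y \<in> I)"
  shows "strong_lefschetz Q (\<lambda>i. h ` poly_grading n i)"
proof -
  have lc: "l ^ j \<in> carrier (poly_ring n)" for j
    using l by (intro power_carrier poly_grading_carrier)
  have mult: "(h l [^]\<^bsub>Q\<^esub> j) \<otimes>\<^bsub>Q\<^esub> h p = h (l ^ j * p)" if "p \<in> poly_grading n i" for i p and j :: nat
    using that l lc[of j] by (simp add: h_mult h_power poly_grading_carrier)
  show ?thesis
    unfolding strong_lefschetz_def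
  proof (intro bexI[of _ "h l"] allI impI)
    fix j i :: nat
    consider "\<And>p. p \<in> poly_grading n i \<Longrightarrow> l ^ j * p \<in> I \<Longrightarrow> p \<in> I"
      | "\<And>y. y \<in> poly_grading n (i + j) \<Longrightarrow> \<exists>p\<in>poly_grading n i. l ^ j * p - y \<in> I"
      using rank[of i j] by blast
    then show "inj_on (\<lambda>a. (h l [^]\<^bsub>Q\<^esub> j) \<otimes>\<^bsub>Q\<^esub> a) (h ` poly_grading n i) \<or>
        (\<lambda>a. (h l [^]\<^bsub>Q\<^esub> j) \<otimes>\<^bsub>Q\<^esub> a) ` (h ` poly_grading n i) = h ` poly_grading n (i + j)"
    proof cases
      case 1
      have inj: "h p = h q"
        if p: "p \<in> poly_grading n i" and q: "q \<in> poly_grading n i"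
          and eq: "h (l ^ j * p) = h (l ^ j * q)" for p q
      proof -
        have pq: "p \<in> carrier (poly_ring n)" "q \<in> carrier (poly_ring n)"
          using p q by (auto intro: poly_grading_carrier)
        then have "l ^ j * (p - q) \<in> I"
          using eq lc[of j] h_eq_iff[of "l ^ j * p" "l ^ j * q"] by (simp add: right_diff_distrib)
        then have "p - q \<in> I" using 1 poly_grading_diff[OF p q] by blast
        then show ?thesis using h_eq_iff pq by blast
      qed
      have "inj_on (\<lambda>a. (h l [^]\<^bsub>Q\<^esub> j) \<otimes>\<^bsub>Q\<^esub> a) (h ` poly_grading n i)"
      proof (rule inj_onI)
        fix x y assume "x \<in> h ` poly_grading n i" "y \<in> h ` poly_grading n i"
        then obtain p q where pq: "p \<in> poly_grading n i" "x = h p" "q \<in> poly_grading n i" "y = h q"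
          by blast
        assume "(h l [^]\<^bsub>Q\<^esub> j) \<otimes>\<^bsub>Q\<^esub> x = (h l [^]\<^bsub>Q\<^esub> j) \<otimes>\<^bsub>Q\<^esub> y"
        then have "h (l ^ j * p) = h (l ^ j * q)" by (simp only: pq mult[OF pq(1)] mult[OF pq(3)])
        then show "x = y" using inj[OF pq(1,3)] pq by simp
      qed
      then show ?thesis ..
    next
      case 2
      have "h (l ^ j * p) \<in> h ` poly_grading n (i + j)" if "p \<in> poly_grading n i" for p
        using poly_grading_mult[OF poly_grading_power[OF l, of j] that] by (auto simp: add.commute)
      moreover have "\<exists>p\<in>poly_grading n i. h (l ^ j * p) = h y" if y: "y \<in> poly_grading n (i + j)" for y
      proof -
        obtain p where p: "p \<in> poly_grading n i" "l ^ j * p - y \<in> I" using 2[OF y] by blast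
        then have "h (l ^ j * p) = h y"
          using h_eq_iff[of "l ^ j * p" y] lc[of j] poly_grading_carrier[OF y]
            poly_grading_carrier[OF p(1)] by simp
        with p(1) show ?thesis by blast
      qed
      ultimately have "(\<lambda>p. h (l ^ j * p)) ` poly_grading n i = h ` poly_grading n (i + j)"
        by (force simp: image_iff)
      moreover have "(\<lambda>a. (h l [^]\<^bsub>Q\<^esub> j) \<otimes>\<^bsub>Q\<^esub> a) ` (h ` poly_grading n i)
          = (\<lambda>p. h (l ^ j * p)) ` poly_grading n i"
        unfolding image_image by (intro image_cong refl mult)
      ultimately have "(\<lambda>a. (h l [^]\<^bsub>Q\<^esub> j) \<otimes>\<^bsub>Q\<^esub> a) ` (h ` poly_grading n i) = h ` poly_grading n (i + j)"
        by simp
      then show ?thesis ..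
    qed
  qed (use l in simp)
qed

lemma h_scalar: "m \<in> monoms n \<Longrightarrow> h (const a) \<otimes>\<^bsub>Q\<^esub> h (single m 1) = h (single m a)"
  using h_mult[of "const a" "single m 1"] by (simp add: const_def mult_single)

lemma grading_0: "h ` poly_grading n 0 = range (\<lambda>a. h (const a))"
proof -
  have "poly_grading n 0 = range (const :: 'k \<Rightarrow> _)"
    by (auto simp: poly_grading_degree_0)
  then show ?thesis by (simp add: image_image)
qed

text \<open>\<open>dimension\<close> grows by line extensions over the scalars; allowing one more
  monomial in the support is such an extension.\<close>

lemma line_extension_eq:
  assumes u: "u \<in> monoms n" and A: "A \<subseteq> monoms n"
  shows "S.line_extension (h ` poly_grading n 0) (h (single u 1)) (h ` {r. keys r \<subseteq> A})
    = h ` {r. keys r \<subseteq> insert u A}"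
proof -
  have *: "S.line_extension (h ` poly_grading n 0) (h (single u 1)) (h ` {r. keys r \<subseteq> A})
      = {h (single u a) \<oplus>\<^bsub>Q\<^esub> h r | a r. keys r \<subseteq> A}"
    unfolding S.line_extension_def set_add_def set_mult_def r_coset_def grading_0
    using u by (auto simp: h_scalar)
  have add: "h (single u a) \<oplus>\<^bsub>Q\<^esub> h r = h (single u a + r)" if "keys r \<subseteq> A" for a r
    using that A u by (subst h_add) (auto simp: carrier_poly_ring)
  have "h (single u a + r) \<in> h ` {r. keys r \<subseteq> insert u A}" if "keys r \<subseteq> A" for a r
  proof (rule imageI, safe)
    fix m assume "m \<in> keys (single u a + r)" "m \<notin> A"
    then show "m = u" using keys_add[of "single u a" r] that by (auto split: if_splits)
  qed
  moreover have "\<exists>a r'. h r = h (single u a + r') \<and> keys r' \<subseteq> A" if "keys r \<subseteq> insert u A" for r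
  proof (intro exI conjI)
    show "h r = h (single u (lookup r u) + (r - single u (lookup r u)))" by simp
    show "keys (r - single u (lookup r u)) \<subseteq> A"
      using that by (force simp: in_keys_iff lookup_minus lookup_single when_def split: if_splits)
  qed
  ultimately show ?thesis unfolding * using add by (auto simp: image_iff) metis+
qed

lemma dimension_span:
  assumes "finite A" "A \<subseteq> monoms n"
  shows "\<exists>N. S.dimension N (h ` poly_grading n 0) (h ` {r. keys r \<subseteq> A})"
  using assms
proof (induction A rule: finite_induct)
  case empty
  have "{r. keys r \<subseteq> {}} = {0 :: 'k mpoly}" by auto
  then show ?case using h_zero S.dimension.zero_dim by (auto intro: exI[of _ 0])
next
  case (insert u A)
  then obtain N where N: "S.dimension N (h ` poly_grading n 0) (h ` {r. keys r \<subseteq> A})" by auto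
  have u: "u \<in> monoms n" "A \<subseteq> monoms n" using insert.prems by auto
  show ?case
  \<comment> \<open>A monomial depending on the earlier ones does not enlarge the span, so the
    dimension is kept.\<close>
  proof (cases "h (single u 1) \<in> h ` {r. keys r \<subseteq> A}")
    case False
    then have "S.dimension (Suc N) (h ` poly_grading n 0)
        (S.line_extension (h ` poly_grading n 0) (h (single u 1)) (h ` {r. keys r \<subseteq> A}))"
      using N u by (intro S.dimension.Suc_dim h_carrier) simp_all
    then show ?thesis unfolding line_extension_eq[OF u] by blast
  next
    case True
    then obtain s where s: "keys s \<subseteq> A" "h (single u 1) = h s" by auto
    have "h ` {r. keys r \<subseteq> insert u A} = h ` {r. keys r \<subseteq> A}"
    proof (intro equalityI subsetI)
      fix x assume "x \<in> h ` {r. keys r \<subseteq> insert u A}"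
      then obtain r where r: "x = h r" "keys r \<subseteq> insert u A" by auto
      define r' where "r' = r - single u (lookup r u) + const (lookup r u) * s"
      have "keys (r - single u (lookup r u)) \<subseteq> A"
        using r(2) by (force simp: in_keys_iff lookup_minus lookup_single when_def split: if_splits)
      moreover have "keys (const (lookup r u) * s) \<subseteq> A"
        using s(1) by (auto simp: in_keys_iff lookup_const_times)
      ultimately have r': "keys r' \<subseteq> A" 
        unfolding r'_def by (intro order_trans[OF keys_add] Un_least)
      have c: "s \<in> carrier (poly_ring n)" "r \<in> carrier (poly_ring n)" "r' \<in> carrier (poly_ring n)"
        "const (lookup r u) \<in> carrier (poly_ring n)" "(single u 1 :: 'k mpoly) \<in> carrier (poly_ring n)"
        using s(1) r(2) r' u by (auto simp: carrier_poly_ring const_def)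
      have "h (const (lookup r u) * s) = h (const (lookup r u) * single u 1)"
        unfolding h_mult[OF c(4,1)] h_mult[OF c(4,5)] s(2) ..
      then have "const (lookup r u) * s - const (lookup r u) * single u 1 \<in> I"
        using h_eq_iff[of "const (lookup r u) * s" "const (lookup r u) * single u 1"] c by simp
      then have "r' - r \<in> I" by (simp add: r'_def const_def mult_single)
      then have "h r' = h r" using c h_eq_iff by blast
      then show "x \<in> h ` {r. keys r \<subseteq> A}" using r' r(1) by (metis image_eqI mem_Collect_eq)
    qed auto
    with N show ?thesis by auto
  qed
qed

text \<open>The last two assumptions place x^u in the socle and make it span the socle; variables
  suffice as annihilators because they have degree 1.\<close>

lemma artinian_gorenstein_image:
  assumes A: "finite A" "A \<subseteq> monoms n"
    and reduce: "\<And>p. p \<in> carrier (poly_ring n) \<Longrightarrow> \<exists>r. keys r \<subseteq> A \<and> p - r \<in> I"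
    and u: "u \<in> monoms n" "single u 1 \<notin> I"
    and annihilates: "\<And>i b. i \<ge> 1 \<Longrightarrow> b \<in> poly_grading n i \<Longrightarrow> b * single u 1 \<in> I"
    and annihilated: "\<And>p. p \<in> carrier (poly_ring n) \<Longrightarrow> (\<And>i. i \<in> {1..n} \<Longrightarrow> var i * p \<in> I) \<Longrightarrow>
      \<exists>a. p - single u a \<in> I"
  shows "artinian_gorenstein Q (\<lambda>i. h ` poly_grading n i)"
proof -
  have "carrier Q = h ` {r. keys r \<subseteq> A}"
  proof (intro equalityI subsetI)
    fix x assume "x \<in> carrier Q"
    then obtain p where p: "p \<in> carrier (poly_ring n)" "x = h p" using surj by auto
    then obtain r where r: "keys r \<subseteq> A" "p - r \<in> I" using reduce by blast
    then have "r \<in> carrier (poly_ring n)" using A by (auto simp: carrier_poly_ring)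
    then have "h p = h r" using h_eq_iff[OF p(1)] r(2) by simp
    then show "x \<in> h ` {r. keys r \<subseteq> A}" using p r by blast
  next
    fix x assume "x \<in> h ` {r. keys r \<subseteq> A}"
    then show "x \<in> carrier Q" using A by (auto simp: carrier_poly_ring intro!: h_carrier)
  qed
  then have 1: "\<exists>N. S.dimension N (h ` poly_grading n 0) (carrier Q)"
    using dimension_span[OF A] by simp
  have span_u: "S.line_extension (h ` poly_grading n 0) (h (single u 1)) {\<zero>\<^bsub>Q\<^esub>}
      = range (\<lambda>a. h (single u a))"
  proof -
    have "{r. keys r \<subseteq> {}} = {0 :: 'k mpoly}" by auto
    then have "S.line_extension (h ` poly_grading n 0) (h (single u 1)) {\<zero>\<^bsub>Q\<^esub>}
      = h ` {r. keys r \<subseteq> {u}}"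
      using line_extension_eq[OF u(1), of "{}"] h_zero by simp
    also have "{r. keys r \<subseteq> {u}} = range (single u :: 'k \<Rightarrow> _)"
    proof (intro equalityI subsetI)
      fix r :: "'k mpoly" assume "r \<in> {r. keys r \<subseteq> {u}}"
      then have "r = single u (lookup r u)"
        by (intro poly_mapping_eqI) (auto simp: lookup_single when_def in_keys_iff)
      then show "r \<in> range (single u)" by blast
    qed (auto split: if_splits)
    finally show ?thesis by (simp add: image_image)
  qed
  have "socle Q (\<lambda>i. h ` poly_grading n i) = range (\<lambda>a. h (single u a))"
  proof (intro equalityI subsetI)
    fix x assume x: "x \<in> socle Q (\<lambda>i. h ` poly_grading n i)"
    then have "x \<in> carrier Q" by (simp add: socle_def)
    then obtain p where p: "p \<in> carrier (poly_ring n)" "x = h p" using surj by auto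
    have "var i * p \<in> I" if i: "i \<in> {1..n}" for i
    proof -
      have "var i \<in> poly_grading n 1"
        using i unfolding var_def by (intro poly_grading_single) simp_all
      then have "h (var i) \<otimes>\<^bsub>Q\<^esub> x = \<zero>\<^bsub>Q\<^esub>"
        using x unfolding socle_def by blast
      then have "h (var i * p) = \<zero>\<^bsub>Q\<^esub>" using p i h_mult[of "var i" p] by simp
      then show ?thesis using ker[of "var i * p"] p(1) i by simp
    qed
    then obtain a where "p - single u a \<in> I" using annihilated[OF p(1)] by blast
    then have "h p = h (single u a)" using h_eq_iff[OF p(1), of "single u a"] u(1) by simp
    then show "x \<in> range (\<lambda>a. h (single u a))" using p(2) by blast
  next
    fix x assume "x \<in> range (\<lambda>a. h (single u a))"
    then obtain a where x: "x = h (single u a)" by blast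
    have "h b \<otimes>\<^bsub>Q\<^esub> x = \<zero>\<^bsub>Q\<^esub>" if b: "b \<in> poly_grading n i" "i \<ge> 1" for b i
    proof -
      have "const a * b \<in> poly_grading n (0 + i)"
        using b by (intro poly_grading_mult) (auto simp: poly_grading_degree_0)
      then have "const a * b * single u 1 \<in> I" using annihilates[of i] b(2) by simp
      moreover have "const a * b * single u 1 = b * single u a"
        by (simp add: const_def mult_single ac_simps flip: mult.assoc)
      ultimately have "h (b * single u a) = \<zero>\<^bsub>Q\<^esub>"
        using ker[of "b * single u a"] u(1) poly_grading_carrier[OF b(1)] by simp
      then show ?thesis
        using x h_mult[of b "single u a"] u(1) poly_grading_carrier[OF b(1)] by simp
    qed
    then show "x \<in> socle Q (\<lambda>i. h ` poly_grading n i)"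
      using x u(1) by (auto simp: socle_def intro!: h_carrier)
  qed
  moreover have "S.dimension (Suc 0) (h ` poly_grading n 0)
      (S.line_extension (h ` poly_grading n 0) (h (single u 1)) {\<zero>\<^bsub>Q\<^esub>})"
    using u ker[of "single u 1"] by (intro S.dimension.Suc_dim S.dimension.zero_dim h_carrier) auto
  ultimately show ?thesis
    using 1 unfolding artinian_gorenstein_def span_u by simp
qed

text \<open>An iterated quotient is again an image of the polynomial ring, and its ideal is the
  preimage of J.\<close>

lemma quotient:
  assumes J: "ideal J Q"
  shows "poly_quotient n (Q Quot J) (\<lambda>p. J +>\<^bsub>Q\<^esub> h p) {p \<in> carrier (poly_ring n). h p \<in> J}"
proof -
  interpret J: ideal J Q by (rule J)
  have cr: "cring (Q Quot J)" by (rule J.quotient_is_cring[OF cring_Q])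
  interpret C: cring "Q Quot J" by (rule cr)
  have zero: "\<zero>\<^bsub>Q Quot J\<^esub> = J" by (simp add: FactRing_def)
  show ?thesis
  proof (rule poly_quotient.intro)
    show "ring_hom_ring (poly_ring n :: 'k mpoly ring) (Q Quot J) (\<lambda>p. J +>\<^bsub>Q\<^esub> h p)"
    proof (rule ring_hom_ringI2)
      show "(\<lambda>p. J +>\<^bsub>Q\<^esub> h p) \<in> Ring.ring_hom (poly_ring n) (Q Quot J)"
        using ring_hom_trans[OF homh J.rcos_ring_hom] by (simp add: o_def)
    qed (rule R.ring_axioms C.ring_axioms)+
    show "poly_quotient_axioms n (Q Quot J) (\<lambda>p. J +>\<^bsub>Q\<^esub> h p) {p \<in> carrier (poly_ring n). h p \<in> J}"
    proof (rule poly_quotient_axioms.intro)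
      show "(\<lambda>p. J +>\<^bsub>Q\<^esub> h p) ` carrier (poly_ring n) = carrier (Q Quot J)"
        unfolding image_image[of "\<lambda>x. J +>\<^bsub>Q\<^esub> x" h, symmetric] surj
        by (auto simp: FactRing_def A_RCOSETS_def RCOSETS_def a_r_coset_def)
      show "J +>\<^bsub>Q\<^esub> h p = \<zero>\<^bsub>Q Quot J\<^esub> \<longleftrightarrow> p \<in> {p \<in> carrier (poly_ring n). h p \<in> J}"
        if p: "p \<in> carrier (poly_ring n)" for p
        unfolding zero using p J.rcos_const_imp_mem[OF h_carrier[OF p]]
          J.a_rcos_const by blast
    qed (rule cr)
  qed
qed

end

lemma poly_quotient_id: "poly_quotient n (poly_ring n) id {0 :: 'k::field mpoly}"
proof (rule poly_quotient.intro)
  show "ring_hom_ring (poly_ring n :: 'k mpoly ring) (poly_ring n) id"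
    by (rule ring_hom_ringI2) (auto simp: Ring.ring_hom_def poly_ring.ring_axioms)
  show "poly_quotient_axioms n (poly_ring n) id {0 :: 'k mpoly}"
    by (rule poly_quotient_axioms.intro) (auto simp: poly_ring_cring)
qed

lemma poly_quotient_Quot:
  fixes J :: "'k::field mpoly set"
  assumes J: "ideal J (poly_ring n)"
  shows "poly_quotient n (poly_ring n Quot J) (\<lambda>p. J +>\<^bsub>poly_ring n\<^esub> p) J"
proof -
  have "{p \<in> carrier (poly_ring n). id p \<in> J} = J"
    using poly_ideal_carrier[OF J] by auto
  then show ?thesis using poly_quotient.quotient[OF poly_quotient_id J] by simp
qed

context poly_quotient
begin

lemma ideal_zero: "ideal {\<zero>\<^bsub>Q\<^esub>} Q"
  by (rule S.zeroideal)

lemma Idl_empty: "Idl\<^bsub>Q\<^esub> {} = {\<zero>\<^bsub>Q\<^esub>}"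
proof
  show "Idl\<^bsub>Q\<^esub> {} \<subseteq> {\<zero>\<^bsub>Q\<^esub>}" by (rule S.genideal_minimal[OF ideal_zero]) simp
  have "ideal (Idl\<^bsub>Q\<^esub> {}) Q" by (rule S.genideal_ideal) simp
  then show "{\<zero>\<^bsub>Q\<^esub>} \<subseteq> Idl\<^bsub>Q\<^esub> {}"
    using additive_subgroup.zero_closed[OF ideal.axioms(1)] by blast
qed

lemma quotient_grading_image:
  "quotient_grading Q (\<lambda>i. h ` poly_grading n i) J = (\<lambda>i. (\<lambda>p. J +>\<^bsub>Q\<^esub> h p) ` poly_grading n i)"
  by (simp add: quotient_grading_def[abs_def] image_image)

end

section \<open>The Artinian case is Gorenstein\<close>

context exponents_coeff
begin

lemma K_0_weight: "p \<in> K \<Longrightarrow> lin wt p = 0"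
  unfolding K_eq_dual dual_def by (auto dest!: bspec[OF _ monoms_0])

lemma compl_0: "compl 0 \<in> monoms n" "monom_degree (compl 0) = top_degree" "wt (compl 0) \<noteq> 0"
  using compl_monoms compl_degree[OF zero_normal] wt_compl_nonzero[OF zero_normal] by simp_all

lemma top_monom_notin_K: "single (compl 0) 1 \<notin> K"
  using K_0_weight[of "single (compl 0) 1"] compl_0(3) by auto

lemma one_notin_K: "1 \<notin> K"
proof
  assume "1 \<in> K"
  then have "single (compl 0) 1 * 1 \<in> K"
    using compl_0(1) by (intro poly_ideal_mult[OF K_ideal]) simp_all
  then show False using top_monom_notin_K by simp
qed

lemma artinian_gorenstein_K:
  assumes "poly_quotient n Q h K"
  shows "artinian_gorenstein Q (\<lambda>i. h ` poly_grading n i)"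
proof (rule poly_quotient.artinian_gorenstein_image[OF assms finite_normal])
  show "normal \<subseteq> monoms n" using normal_monoms by blast
  show "\<exists>r. keys r \<subseteq> normal \<and> p - r \<in> K" if p: "p \<in> carrier (poly_ring n)" for p
    by (rule reduce[OF p]) blast
  show "compl 0 \<in> monoms n" by (rule compl_0)
  show "single (compl 0) 1 \<notin> K" by (rule top_monom_notin_K)
  show "b * single (compl 0) 1 \<in> K" if "i \<ge> 1" and b: "b \<in> poly_grading n i" for i b
  proof -
    have "b * single (compl 0) 1 \<in> poly_grading n (i + top_degree)"
      using compl_0 by (intro poly_grading_mult b poly_grading_single)
    from K_iff_wt[OF this] show ?thesis using \<open>i \<ge> 1\<close> by simp
  qed
  show "\<exists>a. p - single (compl 0) a \<in> K"
    if p: "p \<in> carrier (poly_ring n)" and var_p: "\<And>i. i \<in> {1..n} \<Longrightarrow> var i * p \<in> K" for p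
  proof
    let ?u = "compl 0"
    \<comment> \<open>The multiple of the top monomial is chosen to make Phi vanish on
      \<open>?g\<close>. Every nontrivial monomial test vanishes as well: it contains a variable,
      which sends p into K, and it pushes the top monomial above the top degree.\<close>
    let ?g = "p - single ?u (lin wt p / wt ?u)"
    have lin_g: "lin w ?g = lin w p - lin wt p / wt ?u * w ?u" for w
      using lin_add[of w ?g "single ?u (lin wt p / wt ?u)"] by simp
    have "lin (\<lambda>k. wt (m + k)) ?g = 0" if m: "m \<in> monoms n" for m
    proof (cases "m = 0")
      case True
      then show ?thesis using compl_0(3) by (simp add: lin_g)
    next
      case False
      then obtain i where i: "i \<in> keys m" by (metis all_not_in_conv keys_eq_empty)
      then have i_n: "i \<in> {1..n}" using m by (auto simp: monoms_def)
      have "m - unit_exp i + unit_exp i = m" using i by (intro exp_shift) (simp add: in_keys_iff)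
      then have "single (m - unit_exp i) 1 * (var i * p) = single m 1 * p"
        by (simp add: var_def mult_single flip: mult.assoc)
      moreover have "single (m - unit_exp i) 1 * (var i * p) \<in> K"
        using m by (intro poly_ideal_mult[OF K_ideal] var_p i_n) simp
      ultimately have "lin wt (single m 1 * p) = 0" using K_0_weight by metis
      then have "lin (\<lambda>k. wt (m + k)) p = 0" by (simp add: lin_single_times)
      moreover have "wt (m + ?u) = 0"
      proof (rule ccontr)
        assume "wt (m + ?u) \<noteq> 0"
        then have "monom_degree (m + ?u) = top_degree" using m compl_0(1) by (intro wt_degree) simp_all
        then show False using compl_0(2) False by (simp add: monom_degree_eq_0)
      qed
      ultimately show ?thesis by (simp add: lin_g)
    qed
    then show "?g \<in> K" using p compl_0(1) unfolding K_eq_dual dual_def by simp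
  qed
qed

lemma gorenstein_Quot_K:
  "gorenstein (poly_ring n Quot K) (quotient_grading (poly_ring n) (poly_grading n) K)"
proof -
  interpret poly_quotient n "poly_ring n Quot K" "\<lambda>p. K +>\<^bsub>poly_ring n\<^esub> p" K
    by (rule poly_quotient_Quot[OF K_ideal])
  let ?Q = "poly_ring n Quot K"
  let ?h = "\<lambda>p. K +>\<^bsub>poly_ring n\<^esub> p"
  \<comment> \<open>Even the empty sequence leads to a quotient by the zero ideal, whose elements
    are cosets of cosets; its polynomial kernel is K again.\<close>
  have kernel: "{p \<in> carrier (poly_ring n). ?h p \<in> {\<zero>\<^bsub>?Q\<^esub>}} = K"
    using ker poly_ideal_carrier[OF K_ideal] by auto
  have "regular_sequence ?Q []"
    unfolding regular_sequence_def
  proof (intro conjI)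
    have "?h 1 \<noteq> \<zero>\<^bsub>?Q\<^esub>" using ker[of 1] one_notin_K by simp
    moreover have "?h 1 \<in> carrier ?Q" by (rule h_carrier) simp
    ultimately show "Idl\<^bsub>?Q\<^esub> (set []) \<noteq> carrier ?Q" unfolding list.set Idl_empty by blast
  qed simp_all
  moreover have "artinian_gorenstein (?Q Quot (Idl\<^bsub>?Q\<^esub> (set [])))
      (quotient_grading ?Q (\<lambda>i. ?h ` poly_grading n i) (Idl\<^bsub>?Q\<^esub> (set [])))"
    unfolding list.set Idl_empty quotient_grading_image
    using quotient[OF ideal_zero] unfolding kernel by (rule artinian_gorenstein_K)
  moreover have "quotient_grading (poly_ring n) (poly_grading n) K = (\<lambda>i. ?h ` poly_grading n i)"
    by (simp add: quotient_grading_def[abs_def])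
  ultimately show ?thesis
    unfolding gorenstein_def by (intro exI[of _ "[]"]) simp
qed

end

context lefschetz_exponents
begin

lemma strong_lefschetz_Quot_K:
  "strong_lefschetz (poly_ring n Quot K) (quotient_grading (poly_ring n) (poly_grading n) K)"
proof -
  interpret poly_quotient n "poly_ring n Quot K" "\<lambda>p. K +>\<^bsub>poly_ring n\<^esub> p" K
    by (rule poly_quotient_Quot[OF K_ideal])
  obtain l where "l \<in> poly_grading n 1"
    "\<And>i j. (\<forall>p\<in>poly_grading n i. l ^ j * p \<in> K \<longrightarrow> p \<in> K) \<or>
      (\<forall>y\<in>poly_grading n (i + j). \<exists>p\<in>poly_grading n i. l ^ j * p - y \<in> K)"
    by (rule maximal_rank) blast
  from strong_lefschetz_image[OF this] show ?thesis
    by (simp add: quotient_grading_def[abs_def])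
qed

end

section \<open>The case of Krull dimension one\<close>

locale degenerate =
  fixes n :: nat and d \<alpha> :: "nat \<Rightarrow> nat" and c :: "'k::field"
  assumes n: "n \<ge> 1" and d1: "d (Suc 0) = 0" and \<alpha>: "i \<in> {1..n} \<Longrightarrow> \<alpha> i = 0"
    and proper: "K' n d \<alpha> c \<noteq> carrier (poly_ring n)"
begin

abbreviation K :: "'k mpoly set" where "K \<equiv> K' n d \<alpha> c"

lemma K_ideal: "ideal K (poly_ring n)"
  by (rule K'_ideal[OF n])

lemma one_notin_K: "1 \<notin> K"
  using proper ideal.one_imp_carrier[OF K_ideal] by auto

lemma generator_eq: "var 1 ^ d 1 + const c * (\<Prod>i\<in>{2..n}. var i ^ \<alpha> i) = (const (1 + c) :: 'k mpoly)"
  using \<alpha> by (simp add: d1 const_def single_add)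

text \<open>Otherwise the first generator, the constant 1 + c, would be a unit.\<close>

lemma c_eq: "1 + c = 0"
proof (rule ccontr)
  assume c: "1 + c \<noteq> 0"
  have "const (1 + c) \<in> K"
    unfolding generator_eq[symmetric] by (rule K'_left[OF n]) blast
  then have "const (1 / (1 + c)) * const (1 + c) \<in> K"
    by (intro poly_ideal_mult[OF K_ideal]) (simp_all add: const_def)
  then show False using one_notin_K c by (simp add: const_def mult_single)
qed

lemma var_pow_K: "i \<in> {2..n} \<Longrightarrow> var i ^ d i \<in> K"
  by (rule K'_pow[OF n])

lemma d_pos: "i \<in> {2..n} \<Longrightarrow> 0 < d i"
  using var_pow_K[of i] one_notin_K by (cases "d i = 0") auto

text \<open>The first generator is 0 and the mixed ones repeat the pure powers, which leaves the
  monomial ideal of the x_i^(d_i) with i \<ge> 2.\<close>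

lemma K_eq: "K = {p \<in> carrier (poly_ring n). \<forall>m\<in>keys p. \<exists>i\<in>{2..n}. d i \<le> lookup m i}"
  (is "_ = ?M")
proof
  have M: "ideal ?M (poly_ring n)"
  proof (rule ideal_poly_ringI)
    fix p q assume "p \<in> ?M" "q \<in> ?M"
    then show "p + q \<in> ?M" using keys_add[of p q] by auto
  next
    fix p m and a :: 'k assume p: "p \<in> ?M" and m: "m \<in> monoms n"
    have "\<exists>i\<in>{2..n}. d i \<le> lookup k i" if k: "k \<in> keys (single m a * p)" for k
    proof -
      obtain b where b: "b \<in> keys p" "k = m + b"
        using k keys_mult[of "single m a" p] by (auto split: if_splits)
      then obtain i where "i \<in> {2..n}" "d i \<le> lookup b i" using p by blast
      then show ?thesis using b(2) by (auto simp: lookup_add intro!: bexI[of _ i])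
    qed
    then show "single m a * p \<in> ?M" using p m by auto
  qed auto
  have pow: "var i ^ d i \<in> ?M" if "i \<in> {2..n}" for i
    using that by (auto simp: var_pow intro!: bexI[of _ i])
  show "K \<subseteq> ?M"
  proof (rule K'_least[OF n M])
    show "var 1 ^ d 1 + const c * (\<Prod>i\<in>{2..n}. var i ^ \<alpha> i) \<in> ?M"
      unfolding generator_eq c_eq by (simp add: const_def)
    show "var 1 ^ (d 1 - \<alpha> 1) * var i ^ (d i - \<alpha> i) \<in> ?M" if "i \<in> {2..n}" for i
      using pow[OF that] \<alpha>[of i] that by (simp add: d1)
  qed (rule pow)
  show "?M \<subseteq> K"
  proof
    fix p assume p: "p \<in> ?M"
    have "single m (lookup p m) \<in> K" if m: "m \<in> keys p" for m
    proof -
      have mn: "m \<in> monoms n" using p m by (auto simp: carrier_poly_ring)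
      obtain i where i: "i \<in> {2..n}" "d i \<le> lookup m i" using p m by blast
      have eq: "m = single i (d i) + (m - single i (d i))"
        using i mn by (intro monoms_le[of _ n]) (auto simp: lookup_single when_def)
      have "single (m - single i (d i)) (lookup p m) * var i ^ d i \<in> K"
        using mn by (intro poly_ideal_mult[OF K_ideal] var_pow_K i) simp
      moreover have "single (m - single i (d i)) (lookup p m) * var i ^ d i = single m (lookup p m)"
        by (subst (3) eq) (simp add: var_pow mult_single add.commute)
      ultimately show ?thesis by simp
    qed
    then have "(\<Sum>m\<in>keys p. single m (lookup p m)) \<in> K" by (rule poly_ideal_sum[OF K_ideal])
    then show "p \<in> K" by (simp flip: sum_single)
  qed
qed

text \<open>x_1 occurs in no generator, so multiplication by it brings no new monomial into
  K.\<close>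

lemma var_1_cancel:
  assumes "var 1 * p \<in> K" and p: "p \<in> carrier (poly_ring n)"
  shows "p \<in> K"
  unfolding K_eq
proof (intro CollectI conjI ballI p)
  fix m assume m: "m \<in> keys p"
  have "lookup (var 1 * p) (unit_exp 1 + m) = lookup p m"
    using lookup_single_times[of "unit_exp 1" 1 p m] by (simp add: var_def)
  then have "unit_exp 1 + m \<in> keys (var 1 * p)" using m by (simp add: in_keys_iff)
  then obtain i where i: "i \<in> {2..n}" "d i \<le> lookup (unit_exp 1 + m) i"
    using assms(1) unfolding K_eq by blast
  then show "\<exists>i\<in>{2..n}. d i \<le> lookup m i"
    by (intro bexI[of _ i]) (auto simp: lookup_add lookup_single_not_eq)
qed

lemma var_1_power_cancel: "var 1 ^ j * p \<in> K \<Longrightarrow> p \<in> carrier (poly_ring n) \<Longrightarrow> p \<in> K"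
proof (induction j)
  case (Suc j)
  then have "var 1 ^ j * p \<in> K"
    using n by (intro Suc.IH var_1_cancel[of "var 1 ^ j * p"]) (auto simp: mult.assoc)
  then show ?case using Suc by blast
qed simp

lemma var_1_grading: "var 1 \<in> poly_grading n 1"
  using n unfolding var_def by (intro poly_grading_single) simp_all

lemma strong_lefschetz_Quot_K:
  "strong_lefschetz (poly_ring n Quot K) (quotient_grading (poly_ring n) (poly_grading n) K)"
proof -
  interpret poly_quotient n "poly_ring n Quot K" "\<lambda>p. K +>\<^bsub>poly_ring n\<^esub> p" K
    by (rule poly_quotient_Quot[OF K_ideal])
  have "strong_lefschetz (poly_ring n Quot K) (\<lambda>i. (\<lambda>p. K +>\<^bsub>poly_ring n\<^esub> p) ` poly_grading n i)"
    using var_1_power_cancel poly_grading_carrier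
    by (intro strong_lefschetz_image[OF var_1_grading]) blast
  then show ?thesis by (simp add: quotient_grading_def[abs_def])
qed

lemma gorenstein_Quot_K:
  "gorenstein (poly_ring n Quot K) (quotient_grading (poly_ring n) (poly_grading n) K)"
proof -
  interpret poly_quotient n "poly_ring n Quot K" "\<lambda>p. K +>\<^bsub>poly_ring n\<^esub> p" K
    by (rule poly_quotient_Quot[OF K_ideal])
  interpret Q: cring "poly_ring n Quot K" by (rule cring_Q)
  let ?Q = "poly_ring n Quot K"
  let ?h = "\<lambda>p. K +>\<^bsub>poly_ring n\<^esub> p"
  let ?J = "Idl\<^bsub>?Q\<^esub> {?h (var 1)}"
  \<comment> \<open>With exponent 1 and coefficient 0 the first generator becomes x_1: this is the
    ideal of the Artinian reduction modulo x_1.\<close>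
  define d' where "d' = d(1 := 1)"
  have hx: "?h (var 1) \<in> carrier ?Q" using n by (intro h_carrier) simp
  have J: "ideal ?J ?Q" using hx by (intro S.genideal_ideal) simp
  interpret E: exponents_coeff n d' \<alpha> "0 :: 'k"
    using n \<alpha> d_pos by unfold_locales (auto simp: d'_def)
  have kernel: "{p \<in> carrier (poly_ring n). ?h p \<in> ?J} = E.K" (is "?I = _")
  proof
    have x1: "var 1 \<in> E.K"
      using K'_left[OF n, of "var 1 ^ d' 1 + const 0 * (\<Prod>i\<in>{2..n}. var i ^ \<alpha> i)" d' 0 \<alpha>]
      by (simp add: d'_def const_def)
    have xi: "var i ^ d i \<in> E.K" if "i \<in> {2..n}" for i
      using K'_pow[OF n that, of d' \<alpha> 0] that by (simp add: d'_def)
    have "K \<subseteq> E.K"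
    proof (rule K'_least[OF n E.K_ideal])
      show "var 1 ^ d 1 + const c * (\<Prod>i\<in>{2..n}. var i ^ \<alpha> i) \<in> E.K"
        unfolding generator_eq c_eq using poly_ideal_0[OF E.K_ideal] by (simp add: const_def)
    qed (use xi \<alpha> in \<open>auto simp: d1\<close>)
    show "?I \<subseteq> E.K"
    proof
      fix p assume p: "p \<in> ?I"
      then have "?h p \<in> PIdl\<^bsub>?Q\<^esub> (?h (var 1))" using Q.cgenideal_eq_genideal[OF hx] by simp
      then obtain y where y: "y \<in> carrier ?Q" "?h p = y \<otimes>\<^bsub>?Q\<^esub> ?h (var 1)"
        by (auto simp: cgenideal_def)
      then obtain q where q: "q \<in> carrier (poly_ring n)" "y = ?h q" using surj by blast
      have "?h p = ?h (q * var 1)" using y q n h_mult[of q "var 1"] by simp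
      then have "p - q * var 1 \<in> K" using h_eq_iff[of p "q * var 1"] p q n by simp
      then have "(p - q * var 1) + q * var 1 \<in> E.K"
        using \<open>K \<subseteq> E.K\<close> by (intro poly_ideal_add[OF E.K_ideal] poly_ideal_mult[OF E.K_ideal x1] q) auto
      then show "p \<in> E.K" by simp
    qed
    have I: "ideal ?I (poly_ring n)" by (rule ideal_vimage[OF J])
    have x1: "var 1 \<in> ?I" using n S.genideal_self'[OF hx] by simp
    have xi: "var i ^ d i \<in> ?I" if i: "i \<in> {2..n}" for i
      using var_pow_K[OF i] ker[of "var i ^ d i"] i additive_subgroup.zero_closed[OF ideal.axioms(1)[OF J]]
      by simp
    show "E.K \<subseteq> ?I"
    proof (rule K'_least[OF n I])
      show "var 1 ^ d' 1 + const 0 * (\<Prod>i\<in>{2..n}. var i ^ \<alpha> i) \<in> ?I"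
        using x1 by (simp add: d'_def const_def)
      show "var i ^ d' i \<in> ?I" if "i \<in> {2..n}" for i
        using xi[OF that] that by (simp add: d'_def)
      show "var 1 ^ (d' 1 - \<alpha> 1) * var i ^ (d' i - \<alpha> i) \<in> ?I" if i: "i \<in> {2..n}" for i
      proof -
        have "var 1 * var i ^ d i \<in> ?I" using xi[OF i] n by (intro poly_ideal_mult[OF I]) auto
        then show ?thesis using \<alpha>[of 1] \<alpha>[of i] i by (simp add: d'_def)
      qed
    qed
  qed
  have "regular_sequence ?Q [?h (var 1)]"
    unfolding regular_sequence_def
  proof (intro conjI allI impI ballI)
    show "set [?h (var 1)] \<subseteq> carrier ?Q" using hx by simp
    fix i a assume "i < length [?h (var 1)]" and a: "a \<in> carrier ?Q"
      and mem: "[?h (var 1)] ! i \<otimes>\<^bsub>?Q\<^esub> a \<in> Idl\<^bsub>?Q\<^esub> (set (take i [?h (var 1)]))"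
    then have i: "i = 0" by simp
    obtain p where p: "p \<in> carrier (poly_ring n)" "a = ?h p" using a surj by blast
    have "?h (var 1) \<otimes>\<^bsub>?Q\<^esub> ?h p = \<zero>\<^bsub>?Q\<^esub>" using mem by (simp add: i p(2) Idl_empty)
    then have "var 1 * p \<in> K" using h_mult[of "var 1" p] ker[of "var 1 * p"] p(1) n by simp
    then have "?h p = \<zero>\<^bsub>?Q\<^esub>" using var_1_cancel ker p(1) by blast
    then show "a \<in> Idl\<^bsub>?Q\<^esub> (set (take i [?h (var 1)]))" by (simp add: i p(2) Idl_empty)
  next
    have "?h 1 \<notin> ?J" using kernel E.one_notin_K by auto
    moreover have "?h 1 \<in> carrier ?Q" by (rule h_carrier) simp
    ultimately have "?J \<noteq> carrier ?Q" by blast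
    then show "Idl\<^bsub>?Q\<^esub> (set [?h (var 1)]) \<noteq> carrier ?Q" unfolding list.set .
  qed
  moreover have "artinian_gorenstein (?Q Quot ?J)
      (quotient_grading ?Q (\<lambda>i. ?h ` poly_grading n i) ?J)"
    unfolding quotient_grading_image
    using quotient[OF J] unfolding kernel by (rule E.artinian_gorenstein_K)
  moreover have "quotient_grading (poly_ring n) (poly_grading n) K = (\<lambda>i. ?h ` poly_grading n i)"
    by (simp add: quotient_grading_def[abs_def])
  moreover have "?h (var 1) \<in> ?h ` poly_grading n 1" using var_1_grading by blast
  ultimately show ?thesis
    unfolding gorenstein_def by (intro exI[of _ "[?h (var 1)]"]) auto
qed

end

section \<open>Case distinction on whether d_1 is zero\<close>

theorem theorem2:
  fixes n :: nat and d \<alpha> :: "nat \<Rightarrow> nat" and c :: "'k::field_char_0"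
  assumes "n \<ge> 1"
    and "\<And>i. i \<in> {1..n} \<Longrightarrow> \<alpha> i \<le> d i"
    and "d 1 = (\<Sum>i\<in>{2..n}. \<alpha> i)"
    and "c \<noteq> 0"
    and "K' n d \<alpha> c \<noteq> carrier (poly_ring n)"
  shows "gorenstein (poly_ring n Quot K' n d \<alpha> c)
           (quotient_grading (poly_ring n) (poly_grading n) (K' n d \<alpha> c)) \<and>
         strong_lefschetz (poly_ring n Quot K' n d \<alpha> c)
           (quotient_grading (poly_ring n) (poly_grading n) (K' n d \<alpha> c))"
proof (cases "d 1 = 0")
  case True
  \<comment> \<open>For i \<ge> 2 it is a summand of \<open>d 1\<close>, and \<alpha>_1 is bounded
    by \<open>d 1\<close>.\<close>
  have "\<alpha> i = 0" if "i \<in> {1..n}" for i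
    using that True assms(2)[OF that] assms(3) by (cases "i = 1") auto
  then interpret degenerate n d \<alpha> c
    using assms True by unfold_locales auto
  show ?thesis using gorenstein_Quot_K strong_lefschetz_Quot_K ..
next
  case False
  \<comment> \<open>The remaining locale conditions hold because no generator of a proper ideal
    equals 1.\<close>
  have one: "1 \<notin> K' n d \<alpha> c"
    using assms(5) ideal.one_imp_carrier[OF K'_ideal[OF assms(1), of d \<alpha> c]] by auto
  have "0 < d i" if i: "i \<in> {2..n}" for i
    using K'_pow[OF assms(1) i, of d \<alpha> c] one by (cases "d i = 0") auto
  then have d_pos: "0 < d i" if "i \<in> {1..n}" for i
    using False that by (cases "i = 1") auto
  have proper: "\<alpha> 1 < d 1 \<or> (\<forall>i\<in>{2..n}. \<alpha> i < d i)"
  proof (rule ccontr)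
    assume "\<not> (\<alpha> 1 < d 1 \<or> (\<forall>i\<in>{2..n}. \<alpha> i < d i))"
    then obtain i where "d 1 \<le> \<alpha> 1" "i \<in> {2..n}" "d i \<le> \<alpha> i" by auto
    then show False using K'_right[OF assms(1), of i d \<alpha> c] one by simp
  qed
  interpret lefschetz_exponents n d \<alpha> c
    using assms d_pos proper by unfold_locales auto
  show ?thesis using gorenstein_Quot_K strong_lefschetz_Quot_K ..
qed

end
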